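(* Let $p,q\ge 3$ and $l\ge 1$, and let $G_w$ be a weighted bicyclic graph of order $n$ having at least one pendant vertex, whose base is $\infty(p,l,q)$. Then $$i_-(G_w)\ge \begin{cases}\frac{p+q}{2}, & \text{if } p,q \text{ are both odd};\\ \frac{p+q}{2}-1, & \text{if } p,q \text{ are both even};\\ \frac{p+q-1}{2}, & \text{otherwise.}\end{cases}$$ Moreover, this bound is sharp.
   Context: A weighted graph $G_w$ is a simple graph $G$ with a positive weight on each edge; its adjacency matrix has entry $w(v_iv_j)$ if $v_iv_j\in E(G)$ and $0$ otherwise, and $i_+(G_w)$ (resp. $i_-(G_w)$, $i_0(G_w)$) is the number of positive (resp. negative, zero) eigenvalues of this matrix, with multiplicity. A bicyclic graph is a connected simple graph with $|E|=|V|+1$. The base of a bicyclic graph $G$ is its unique bicyclic subgraph containing no pendant vertices (so $G$ is obtained from its base by attaching trees). For $p,q\ge 3$ and $l\ge1$, $\infty(p,l,q)$ is the graph obtained from two vertex-disjoint cycles $C^p$, $C^q$ (of lengths $p,q$) and a path $P_l=v_1v_2\cdots v_l$ on $l$ vertices by identifying $v_1$ with a vertex $v$ of $C^p$ and $v_l$ with a vertex $u$ of $C^q$ (when $l=1$ the two cycles share exactly one vertex). *)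

theory Defs
  imports
    Complex_Main
    "Jordan_Normal_Form.Char_Poly"
    "Graph_Theory.Graph_Theory"
begin

text \<open>Simple graphs are finite symmetric loop-free digraphs (locale \<^locale>\<open>pair_graph\<close>): an
  undirected edge \<open>uv\<close> is represented by the two arcs \<open>(u, v)\<close> and \<open>(v, u)\<close>.\<close>

definition uedges :: "'a pair_pre_digraph \<Rightarrow> 'a set set" where
  "uedges G = {{u, v} | u v. (u, v) \<in> parcs G}"

definition weighting :: "'a pair_pre_digraph \<Rightarrow> ('a \<times> 'a) weight_fun \<Rightarrow> bool" where
  "weighting G w \<longleftrightarrow> (\<forall>(u, v) \<in> parcs G. w (u, v) > 0 \<and> w (v, u) = w (u, v))"

definition weighted_adj_mat ::
    "'a list \<Rightarrow> 'a pair_pre_digraph \<Rightarrow> ('a \<times> 'a) weight_fun \<Rightarrow> real mat" where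
  "weighted_adj_mat vs G w = mat (length vs) (length vs)
     (\<lambda>(i, j). if (vs ! i, vs ! j) \<in> parcs G then w (vs ! i, vs ! j) else 0)"

text \<open>The matrix is symmetric, so all complex eigenvalues are real and their geometric and algebraic
  multiplicities agree; the multiplicity is taken as the order of the root of the
  characteristic polynomial.\<close>

definition neg_eigenvalue_count :: "real mat \<Rightarrow> nat" where
  "neg_eigenvalue_count A = (\<Sum>x | eigenvalue A x \<and> x < 0. order x (char_poly A))"

text \<open>The enumeration of the vertices is immaterial: another one conjugates the
  adjacency matrix by a permutation matrix.\<close>

definition neg_inertia :: "'a pair_pre_digraph \<Rightarrow> ('a \<times> 'a) weight_fun \<Rightarrow> nat" where
  "neg_inertia G w =
     neg_eigenvalue_count
       (weighted_adj_mat (SOME vs. distinct vs \<and> set vs = pverts G) G w)"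

definition bicyclic :: "'a pair_pre_digraph \<Rightarrow> bool" where
  "bicyclic G \<longleftrightarrow> pair_graph G \<and> Digraph_Component.connected (with_proj G) \<and>
     card (uedges G) = card (pverts G) + 1"

definition has_pendant :: "'a pair_pre_digraph \<Rightarrow> bool" where
  "has_pendant G \<longleftrightarrow> (\<exists>v \<in> pverts G. out_degree (with_proj G) v = 1)"

text \<open>For a bicyclic \<open>G\<close> there is exactly one such \<open>B\<close>.\<close>

definition is_base :: "'a pair_pre_digraph \<Rightarrow> 'a pair_pre_digraph \<Rightarrow> bool" where
  "is_base B G \<longleftrightarrow> subgraph (with_proj B) (with_proj G) \<and> bicyclic B \<and> \<not> has_pendant B"

definition cycle_arcs :: "nat \<Rightarrow> nat \<Rightarrow> nat rel" where
  "cycle_arcs a k = {(a + i, a + ((i + 1) mod k)) | i. i < k}"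

definition path_arcs :: "nat \<Rightarrow> nat \<Rightarrow> nat rel" where
  "path_arcs a k = {(a + i, a + i + 1) | i. i + 1 < k}"

text \<open>The cycle of length \<open>p\<close> occupies \<open>0, \<dots>, p - 1\<close>, the path on \<open>l\<close> vertices
  \<open>p - 1, \<dots>, p + l - 2\<close>, and the cycle of length \<open>q\<close> \<open>p + l - 2, \<dots>, p + l + q - 3\<close>; the shared
  numbers \<open>p - 1\<close> and \<open>p + l - 2\<close> (equal for \<open>l = 1\<close>) are the identified vertices.\<close>

definition infinity_graph :: "nat \<Rightarrow> nat \<Rightarrow> nat \<Rightarrow> nat pair_pre_digraph" where
  "infinity_graph p l q =
     (let R = cycle_arcs 0 p \<union> path_arcs (p - 1) l \<union> cycle_arcs (p + l - 2) q
      in \<lparr> pverts = {0..<p + l + q - 2}, parcs = R \<union> R\<inverse> \<rparr>)"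

definition inertia_bound :: "nat \<Rightarrow> nat \<Rightarrow> real" where
  "inertia_bound p q =
     (if odd p \<and> odd q then (real p + real q) / 2
      else if even p \<and> even q then (real p + real q) / 2 - 1
      else (real p + real q - 1) / 2)"

end

theory Submission
  imports
    Defs
    "Jordan_Normal_Form.Schur_Decomposition"
    "Jordan_Normal_Form.Spectral_Radius"
begin

text \<open>Deleting a pendant vertex \<open>y\<close> together with its neighbour \<open>x\<close> lowers \<open>i\<^sub>-\<close> by exactly one, so
  a sequence of \<open>k\<close> pairs \<open>(y, x)\<close>, each \<open>y\<close> adjacent to its \<open>x\<close> but to no vertex of a later pair,
  forces \<open>i\<^sub>- \<ge> k\<close>. Since \<open>G\<close> has as many edges outside its base as vertices, its base is induced
  and some vertex \<open>y\<close> outside it has a single neighbour \<open>x\<close>. After the pair \<open>(y, x)\<close>, whatever \<open>x\<close>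
  is, the base without \<open>x\<close> still admits \<open>(p - 1) div 2 + (q - 1) div 2\<close> pairs: eliminate the cycle
  containing \<open>x\<close>, opened at \<open>x\<close>, and then the other cycle, opened at its attachment vertex. The
  resulting number of pairs is the claimed bound for all parities.

  For two cycles sharing a vertex that carries one pendant vertex, an independent set with
  \<open>1 + p div 2 + q div 2\<close> of the \<open>p + q\<close> vertices is a totally isotropic subspace, which gives the
  matching upper bound.\<close>

section \<open>Inertia of real symmetric matrices\<close>

text \<open>Over the complex numbers an eigenvalue exists because \<open>n > 0\<close>; symmetry
  makes it equal to its conjugate, so it is a real root of the characteristic polynomial.\<close>

lemma real_symmetric_eigenvalue:
  fixes A :: "real mat"
  assumes A: "A \<in> carrier_mat n n" and sym: "A\<^sup>T = A" and n: "n > 0"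
  shows "\<exists>e. eigenvalue A e"
proof -
  let ?C = "map_mat complex_of_real A"
  have C: "?C \<in> carrier_mat n n" using A by simp
  have csym: "?C\<^sup>T = ?C" using sym
    by (metis map_mat_transpose)
  from spectrum_non_empty[OF C n] obtain z where z: "eigenvalue ?C z"
    unfolding spectrum_def by auto
  then obtain v where v: "v \<in> carrier_vec n" "v \<noteq> 0\<^sub>v n" "?C *\<^sub>v v = z \<cdot>\<^sub>v v"
    unfolding eigenvalue_def eigenvector_def using A by auto
  have pos: "v \<bullet>c v \<noteq> 0" using v by simp
  have cv: "conjugate v \<in> carrier_vec n" using v by simp
  have conj_eq: "conjugate (?C *\<^sub>v v) = ?C *\<^sub>v conjugate v"
  proof (rule eq_vecI)
    show "dim_vec (conjugate (?C *\<^sub>v v)) = dim_vec (?C *\<^sub>v conjugate v)" by simp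
    fix i assume "i < dim_vec (?C *\<^sub>v conjugate v)"
    then have i: "i < n" using A by simp
    show "conjugate (?C *\<^sub>v v) $ i = (?C *\<^sub>v conjugate v) $ i"
      using i A v(1) by (simp add: scalar_prod_def)
  qed
  have "z * (v \<bullet>c v) = (?C *\<^sub>v v) \<bullet>c v" using v by simp
  also have "\<dots> = v \<bullet> (?C *\<^sub>v conjugate v)"
    using transpose_vec_mult_scalar[OF C cv v(1)] unfolding csym
    by (simp add: comm_scalar_prod[of _ n] v C A cv)
  also have "\<dots> = v \<bullet>c (z \<cdot>\<^sub>v v)" using conj_eq v(3) by simp
  also have "\<dots> = cnj z * (v \<bullet>c v)"
    using v by (simp add: conjugate_smult_vec)
  finally have "z = cnj z" using pos by simp
  then obtain e where e: "z = complex_of_real e"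
    by (metis Reals_cases Reals_cnj_iff)
  have "poly (char_poly ?C) z = 0" using z eigenvalue_root_char_poly[OF C] by blast
  then have "complex_of_real (poly (char_poly A) e) = 0"
    unfolding of_real_hom.char_poly_hom[OF A] e by simp
  then have "eigenvalue A e" using eigenvalue_root_char_poly[OF A] by simp
  then show ?thesis by blast
qed

text \<open>Complete \<open>v\<close> to a basis starting with \<open>v\<close>, apply Gram-Schmidt,
  which keeps the first vector, and rescale; hence the first column is only a multiple of
  \<open>v\<close>.\<close>

lemma orthonormal_completion:
  fixes v :: "real vec"
  assumes v: "v \<in> carrier_vec n" "v \<noteq> 0\<^sub>v n"
  obtains W where "W \<in> carrier_mat n n" "W\<^sup>T * W = 1\<^sub>m n" "\<exists>c. col W 0 = c \<cdot>\<^sub>v v"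
proof -
  have n: "n > 0" using v by (cases n) auto
  interpret cof_vec_space n "TYPE(real)" .
  define b where "b = basis_completion v"
  define ws where "ws = gram_schmidt n b"
  from basis_completion[OF v, folded b_def]
  have dist_b: "distinct b" 
    and indep: "\<not> lin_dep (set b)" and b: "set b \<subseteq> carrier_vec n" and hdb: "hd b = v" 
    and len_b: "length b = n" by auto
  from hdb len_b n obtain vs where bv: "b = v # vs" by (cases b, auto)
  from gram_schmidt_result[OF b dist_b indep refl, folded ws_def]
  have ws: "set ws \<subseteq> carrier_vec n" "corthogonal ws" "length ws = n" 
    by (auto simp: len_b)
  from gram_schmidt_hd[OF v(1), of vs, folded bv] have hdws: "hd ws = v" unfolding ws_def .
  then have ws0: "ws ! 0 = v" using ws(3) n by (metis hd_conv_nth list.size(3) not_gr0)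
  have wsc: "ws ! i \<in> carrier_vec n" if "i < n" for i using ws that by auto
  \<comment> \<open>\<open>gram_schmidt\<close> yields orthogonal but not normalised vectors;
    \<open>r i\<close> is the reciprocal norm of \<open>ws ! i\<close>.\<close>
  define r where "r = (\<lambda>i. 1 / sqrt (ws ! i \<bullet> ws ! i))"
  define us where "us = map (\<lambda>i. r i \<cdot>\<^sub>v ws ! i) [0..<n]"
  define W where "W = mat_of_cols n us"
  have lus: "length us = n" by (simp add: us_def)
  have usc: "us ! i = r i \<cdot>\<^sub>v ws ! i" if "i < n" for i using that by (simp add: us_def)
  have usc': "us ! i \<in> carrier_vec n" if "i < n" for i using that wsc usc by simp
  have W: "W \<in> carrier_mat n n" unfolding W_def using lus by auto
  have colW: "col W i = us ! i" if "i < n" for i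
    unfolding W_def using that lus usc' by (simp add: col_mat_of_cols)
  have prod: "us ! i \<bullet> us ! j = (if i = j then 1 else 0)" if i: "i < n" and j: "j < n" for i j
  proof -
    have eq: "us ! i \<bullet> us ! j = r i * (r j * (ws ! i \<bullet> ws ! j))"
      using wsc[OF i] wsc[OF j] by (simp add: usc i j)
    show ?thesis
    proof (cases "i = j")
      case True
      have "ws ! i \<bullet> ws ! i \<noteq> 0" using corthogonalD[OF ws(2), of i i] i ws(3) by simp
      moreover have "ws ! i \<bullet> ws ! i \<ge> 0" using conjugate_square_ge_0_vec[of "ws ! i"] by simp
      ultimately have "ws ! i \<bullet> ws ! i > 0" by simp
      then show ?thesis using True unfolding eq r_def by (simp add: field_simps)
    next
      case False
      then show ?thesis using corthogonalD[OF ws(2), of i j] i j ws(3) unfolding eq by simp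
    qed
  qed
  have "W\<^sup>T * W = 1\<^sub>m n"
    by (rule eq_matI) (use W in \<open>auto simp: colW prod\<close>)
  moreover have "\<exists>c. col W 0 = c \<cdot>\<^sub>v v" using colW[OF n] usc[OF n] ws0 by auto
  ultimately show ?thesis using W that by blast
qed

text \<open>Induction on the size: an orthogonal matrix whose first column is an eigenvector splits
  off a block of size one, and the induction hypothesis diagonalises the remaining symmetric
  block.\<close>

lemma real_symmetric_orthogonal_diagonalization:
  fixes A :: "real mat"
  assumes "A \<in> carrier_mat n n" and "A\<^sup>T = A"
  shows "\<exists>P D. P \<in> carrier_mat n n \<and> D \<in> carrier_mat n n \<and> P\<^sup>T * P = 1\<^sub>m n
    \<and> diagonal_mat D \<and> P\<^sup>T * A * P = D"
  using assms
proof (induction n arbitrary: A)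
  case 0
  then show ?case
    by (intro exI[of _ "0\<^sub>m 0 0"]) (auto simp: diagonal_mat_def)
next
  case (Suc n A)
  let ?N = "Suc n"
  note A = Suc.prems(1) and sym = Suc.prems(2)
  from real_symmetric_eigenvalue[OF A sym] obtain e where "eigenvalue A e" by auto
  then obtain v where v: "v \<in> carrier_vec ?N" "v \<noteq> 0\<^sub>v ?N" "A *\<^sub>v v = e \<cdot>\<^sub>v v"
    unfolding eigenvalue_def eigenvector_def using A by auto
  from orthonormal_completion[OF v(1,2)] obtain W c where W: "W \<in> carrier_mat ?N ?N"
    and WW: "W\<^sup>T * W = 1\<^sub>m ?N" and c: "col W 0 = c \<cdot>\<^sub>v v" by metis
  have WT: "W\<^sup>T \<in> carrier_mat ?N ?N" using W by simp
  have WW': "W * W\<^sup>T = 1\<^sub>m ?N" by (rule mat_mult_left_right_inverse[OF WT W WW])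
  have Acol: "A *\<^sub>v col W 0 = e \<cdot>\<^sub>v col W 0"
    unfolding c using v A by (simp add: mult_mat_vec smult_smult_assoc mult.commute)
  define A' where "A' = W\<^sup>T * A * W"
  have A': "A' \<in> carrier_mat ?N ?N" unfolding A'_def using W WT A by simp
  have symA': "A'\<^sup>T = A'"
    unfolding A'_def using W WT A sym
    by (simp add: transpose_mult[of _ ?N ?N _ ?N] assoc_mult_mat[of _ ?N ?N _ ?N _ ?N])
  \<comment> \<open>Column 0 of \<open>W\<close> is an eigenvector, so orthonormality of the columns
    leaves only the top entry.\<close>
  have col0: "A' $$ (i, 0) = (if i = 0 then e else 0)" if i: "i < ?N" for i
  proof -
    have "A' $$ (i, 0) = (W\<^sup>T * (A * W)) $$ (i, 0)"
      unfolding A'_def using assoc_mult_mat[OF WT A W] by simp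
    also have "\<dots> = col W i \<bullet> col (A * W) 0" using i W A by simp
    also have "col (A * W) 0 = A *\<^sub>v col W 0" by (rule col_mult2[OF A W]) simp
    also have "col W i \<bullet> (A *\<^sub>v col W 0) = e * (col W i \<bullet> col W 0)"
      unfolding Acol using W i by (metis scalar_prod_smult_right col_dim carrier_matD(1) carrier_vecD carrier_vecI)
    also have "col W i \<bullet> col W 0 = (W\<^sup>T * W) $$ (i, 0)"
      using W i by simp
    finally show ?thesis unfolding WW using i by simp
  qed
  have row0: "A' $$ (0, i) = (if i = 0 then e else 0)" if i: "i < ?N" for i
    using col0[OF i] symA' A' i by (metis carrier_matD index_transpose_mat(1) zero_less_Suc)
  define A3 where "A3 = mat n n (\<lambda>(i,j). A' $$ (Suc i, Suc j))"
  have A3: "A3 \<in> carrier_mat n n" by (simp add: A3_def)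
  have symA3: "A3\<^sup>T = A3"
  proof (rule eq_matI)
    fix i j assume "i < dim_row A3" "j < dim_col A3"
    then have ij: "i < n" "j < n" using A3 by auto
    have "A' $$ (Suc j, Suc i) = A'\<^sup>T $$ (Suc i, Suc j)" using ij A' by simp
    then show "A3\<^sup>T $$ (i, j) = A3 $$ (i, j)" using ij unfolding A3_def symA' by simp
  qed (use A3 in auto)
  define E where "E = mat 1 1 (\<lambda>_. e)"
  have E: "E \<in> carrier_mat 1 1" by (simp add: E_def)
  have blk: "A' = four_block_mat E (0\<^sub>m 1 n) (0\<^sub>m n 1) A3" (is "_ = ?B")
  proof (rule eq_matI)
    fix i j assume "i < dim_row ?B" "j < dim_col ?B"
    then have ij: "i < ?N" "j < ?N" using A3 E by auto
    show "A' $$ (i, j) = ?B $$ (i, j)"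
      using ij A3 E col0[OF ij(1)] row0[OF ij(2)]
      by (cases i; cases j) (auto simp: A3_def E_def)
  qed (use A' A3 E in auto)
  from Suc.IH[OF A3 symA3] obtain P D where P: "P \<in> carrier_mat n n" and D: "D \<in> carrier_mat n n"
    and PP: "P\<^sup>T * P = 1\<^sub>m n" and diag: "diagonal_mat D" and eq: "P\<^sup>T * A3 * P = D" by blast
  define Q where "Q = four_block_mat (1\<^sub>m 1) (0\<^sub>m 1 n) (0\<^sub>m n 1) P"
  have Q: "Q \<in> carrier_mat ?N ?N" unfolding Q_def using P by auto
  have QT: "Q\<^sup>T = four_block_mat (1\<^sub>m 1) (0\<^sub>m 1 n) (0\<^sub>m n 1) P\<^sup>T"
    unfolding Q_def using P by (simp add: transpose_four_block_mat[of _ 1 1 _ n _ n])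
  have QTc: "Q\<^sup>T \<in> carrier_mat ?N ?N" using Q by simp
  have QQ: "Q\<^sup>T * Q = 1\<^sub>m ?N"
    unfolding QT unfolding Q_def using P PP
    by (simp add: mult_four_block_mat[of _ 1 1 _ n _ n _ _ 1 _ n])
  let ?D = "four_block_mat E (0\<^sub>m 1 n) (0\<^sub>m n 1) D"
  have QAQ: "Q\<^sup>T * A' * Q = ?D"
    unfolding QT blk unfolding Q_def using P A3 E D eq
    by (simp add: mult_four_block_mat[of _ 1 1 _ n _ n _ _ 1 _ n])
  have D': "?D \<in> carrier_mat ?N ?N" using D E by auto
  have diagD': "diagonal_mat ?D"
    unfolding diagonal_mat_def
  proof (intro allI impI)
    fix i j assume ij: "i < dim_row ?D" "j < dim_col ?D" "i \<noteq> j"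
    then show "?D $$ (i, j) = 0"
      using diag[unfolded diagonal_mat_def] D E by (cases i; cases j) auto
  qed
  let ?P = "W * Q"
  have P': "?P \<in> carrier_mat ?N ?N" using W Q by simp
  have PT: "?P\<^sup>T = Q\<^sup>T * W\<^sup>T" using W Q by (simp add: transpose_mult)
  have "?P\<^sup>T * ?P = Q\<^sup>T * (W\<^sup>T * W) * Q" unfolding PT using W Q WT QTc
    by (simp add: assoc_mult_mat[of _ ?N ?N _ ?N _ ?N])
  then have 1: "?P\<^sup>T * ?P = 1\<^sub>m ?N" unfolding WW using QQ QTc by simp
  have 2: "?P\<^sup>T * A * ?P = Q\<^sup>T * A' * Q" unfolding PT A'_def using W Q WT QTc A
    by (simp add: assoc_mult_mat[of _ ?N ?N _ ?N _ ?N])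
  show ?case using P' D' 1 2 QAQ diagD' by metis
qed

text \<open>The characteristic polynomial is the product of the linear factors of the diagonal
  entries, so the order of a root is how often it occurs on the diagonal.\<close>

lemma neg_eigenvalue_count_diagonal:
  assumes sim: "similar_mat A D" and D: "D \<in> carrier_mat n n" and diag: "diagonal_mat D"
  shows "neg_eigenvalue_count A = card {i. i < n \<and> D $$ (i, i) < 0}"
proof -
  have A: "A \<in> carrier_mat n n" using similar_matD[OF sim] D by auto
  let ?es = "diag_mat D"
  have ut: "upper_triangular D" using diag D by (auto simp: diagonal_mat_def)
  have cp: "char_poly A = (\<Prod>e\<leftarrow>?es. [:- e, 1:])"
    unfolding char_poly_similar[OF sim] by (rule char_poly_upper_triangular[OF D ut])
  have ord: "order x (\<Prod>e\<leftarrow>es. [:- e, 1:]) = count_list es x" for x :: real and es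
  proof (induction es)
    case (Cons e es)
    have nz: "(\<Prod>e\<leftarrow>es. [:- e, 1:]) \<noteq> 0" by (auto simp: prod_list_zero_iff)
    have "order x [:- e, 1:] = (if e = x then 1 else 0)"
      by (auto simp: order_linear' intro: order_0I)
    then show ?case using Cons nz by (simp add: order_mult del: mult_pCons_left)
  qed simp
  have ev: "{x. eigenvalue A x \<and> x < 0} = set (filter (\<lambda>x. x < 0) ?es)"
    unfolding eigenvalue_root_char_poly[OF A] cp by (auto simp: poly_prod_list prod_list_zero_iff)
  have "neg_eigenvalue_count A = (\<Sum>x\<in>set (filter (\<lambda>x. x < 0) ?es). count_list ?es x)"
    unfolding neg_eigenvalue_count_def ev by (simp add: cp ord)
  \<comment> \<open>Filtering does not change how often a negative entry occurs, and the occurrence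
    counts of all entries of a list add up to its length.\<close>
  also have "\<dots> = (\<Sum>x\<in>set (filter (\<lambda>x. x < 0) ?es). count_list (filter (\<lambda>x. x < 0) ?es) x)"
    by (intro sum.cong refl) (auto simp: count_list_eq_length_filter intro!: arg_cong[where f = length] filter_cong)
  also have "\<dots> = length (filter (\<lambda>x. x < 0) ?es)" by (rule sum_count_set) auto
  also have "\<dots> = card {i. i < length ?es \<and> ?es ! i < 0}" by (rule length_filter_conv_card)
  also have "{i. i < length ?es \<and> ?es ! i < 0} = {i. i < n \<and> D $$ (i, i) < 0}"
    using D by (auto simp: diag_mat_def)
  finally show ?thesis .
qed

text \<open>\<open>L\<close> is the coordinate change to an orthonormal basis of eigenvectors, so the entries of
  \<open>\<beta>\<close> are the eigenvalues.\<close>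

lemma quadratic_form_sum_of_squares:
  fixes A :: "real mat"
  assumes A: "A \<in> carrier_mat n n" and sym: "A\<^sup>T = A"
  shows "\<exists>L \<beta>. L \<in> carrier_mat n n
    \<and> (\<forall>x \<in> carrier_vec n. x \<bullet> (A *\<^sub>v x) = (\<Sum>i<n. \<beta> i * ((L *\<^sub>v x) $ i)\<^sup>2))
    \<and> (\<forall>x \<in> carrier_vec n. L *\<^sub>v x = 0\<^sub>v n \<longrightarrow> x = 0\<^sub>v n)
    \<and> neg_eigenvalue_count A = card {i. i < n \<and> \<beta> i < 0}"
proof -
  from real_symmetric_orthogonal_diagonalization[OF A sym] obtain P D where
    P: "P \<in> carrier_mat n n" and D: "D \<in> carrier_mat n n" and PP: "P\<^sup>T * P = 1\<^sub>m n"
    and diag: "diagonal_mat D" and eq: "P\<^sup>T * A * P = D" by blast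
  have PT: "P\<^sup>T \<in> carrier_mat n n" using P by simp
  have PP': "P * P\<^sup>T = 1\<^sub>m n" by (rule mat_mult_left_right_inverse[OF PT P PP])
  have A_eq: "A = P * D * P\<^sup>T"
  proof -
    have "P * D * P\<^sup>T = (P * P\<^sup>T) * A * (P * P\<^sup>T)" unfolding eq[symmetric]
      using P PT A by (simp add: assoc_mult_mat[of _ n n _ n _ n])
    then show ?thesis unfolding PP' using A by simp
  qed
  have "similar_mat A D"
    unfolding similar_mat_def similar_mat_wit_def Let_def
    using A P PT D PP PP' A_eq by (intro exI[of _ P] exI[of _ "P\<^sup>T"]) auto
  note count = neg_eigenvalue_count_diagonal[OF this D diag]
  show ?thesis
  proof (intro exI conjI ballI impI, rule PT)
    show "neg_eigenvalue_count A = card {i. i < n \<and> D $$ (i, i) < 0}" by (rule count)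
  next
    fix x :: "real vec" assume x: "x \<in> carrier_vec n"
    define y where "y = P\<^sup>T *\<^sub>v x"
    have y: "y \<in> carrier_vec n" unfolding y_def using PT x by simp
    have "A *\<^sub>v x = P *\<^sub>v (D *\<^sub>v y)" unfolding A_eq y_def using P D PT x
      by (simp add: assoc_mult_mat_vec[of _ n n _ n])
    then have "x \<bullet> (A *\<^sub>v x) = y \<bullet> (D *\<^sub>v y)" unfolding y_def
      using transpose_vec_mult_scalar[OF P, of "D *\<^sub>v y" x] D x y by (simp add: y_def)
    also have "\<dots> = (\<Sum>i<n. y $ i * (D *\<^sub>v y) $ i)"
      using D y by (simp add: scalar_prod_def lessThan_atLeast0)
    also have "\<dots> = (\<Sum>i<n. D $$ (i, i) * (y $ i)\<^sup>2)"
    proof (rule sum.cong[OF refl])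
      fix i assume "i \<in> {..<n}"
      then have i: "i < n" by simp
      have "(D *\<^sub>v y) $ i = (\<Sum>j\<in>{0..<n}. D $$ (i, j) * y $ j)"
        using i D y by (simp add: scalar_prod_def)
      also have "\<dots> = (\<Sum>j\<in>{0..<n}. if j = i then D $$ (i, i) * y $ i else 0)"
        using diag[unfolded diagonal_mat_def] i D by (intro sum.cong) auto
      also have "\<dots> = D $$ (i, i) * y $ i" using i by simp
      finally show "y $ i * (D *\<^sub>v y) $ i = D $$ (i, i) * (y $ i)\<^sup>2"
        by (simp add: power2_eq_square)
    qed
    finally show "x \<bullet> (A *\<^sub>v x) = (\<Sum>i<n. D $$ (i, i) * ((P\<^sup>T *\<^sub>v x) $ i)\<^sup>2)" unfolding y_def .
  next
    fix x :: "real vec" assume x: "x \<in> carrier_vec n" and 0: "P\<^sup>T *\<^sub>v x = 0\<^sub>v n"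
    have "x = (P * P\<^sup>T) *\<^sub>v x" unfolding PP' using x by simp
    also have "\<dots> = P *\<^sub>v (P\<^sup>T *\<^sub>v x)" using P PT x by (rule assoc_mult_mat_vec)
    also have "\<dots> = 0\<^sub>v n" unfolding 0 using P by auto
    finally show "x = 0\<^sub>v n" .
  qed
qed

text \<open>The equations with index in \<open>I\<close>, padded with zero rows to a square system,
  have determinant zero and hence a nontrivial kernel.\<close>

lemma underdetermined_system_solution:
  fixes M :: "real mat"
  assumes M: "M \<in> carrier_mat n k" and I: "I \<subseteq> {..<n}" "card I < k"
  shows "\<exists>c \<in> carrier_vec k. c \<noteq> 0\<^sub>v k \<and> (\<forall>i\<in>I. (M *\<^sub>v c) $ i = 0)"
proof -
  have fin: "finite I" using I(1) finite_subset by auto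
  obtain h where h: "bij_betw h {0..<card I} I" using ex_bij_betw_nat_finite[OF fin] by blast
  define S where "S = mat k k (\<lambda>(a, j). if a < card I then M $$ (h a, j) else 0)"
  have S: "S \<in> carrier_mat k k" by (simp add: S_def)
  have "row S (card I) = 0\<^sub>v k" using I(2) by (auto simp: S_def)
  then have "S = mat\<^sub>r k k (\<lambda>i. if i = card I then 0\<^sub>v k else row S i)"
    using S by (intro eq_rowI) auto
  then have "det S = 0"
    using det_row_0[OF I(2), of "row S"] S by (auto simp: row_carrier_vec)
  then obtain c where c: "c \<in> carrier_vec k" "c \<noteq> 0\<^sub>v k" "S *\<^sub>v c = 0\<^sub>v k"
    using det_0_iff_vec_prod_zero_field[OF S] by auto
  have "(M *\<^sub>v c) $ i = 0" if "i \<in> I" for i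
  proof -
    from that obtain a where a: "a < card I" "h a = i"
      using h unfolding bij_betw_def by (metis atLeastLessThan_iff imageE)
    have i: "i < n" using \<open>i \<in> I\<close> I by auto
    have ak: "a < k" using a I(2) by simp
    have "row S a = row M i" using a ak i M by (auto simp: S_def)
    then have "(M *\<^sub>v c) $ i = (S *\<^sub>v c) $ a" using a ak i M S by simp
    then show ?thesis using c(3) ak by simp
  qed
  with c(1,2) show ?thesis by blast
qed

text \<open>One half of Sylvester's law: with fewer than \<open>k\<close> negative eigenvalues, some
  nonzero combination of the columns has vanishing coordinates at all of them, and there the form is
  nonnegative.\<close>

lemma neg_eigenvalue_count_ge:
  fixes A :: "real mat"
  assumes A: "A \<in> carrier_mat n n" "A\<^sup>T = A" and M: "M \<in> carrier_mat n k"
    and neg: "\<And>c. c \<in> carrier_vec k \<Longrightarrow> c \<noteq> 0\<^sub>v k \<Longrightarrow> (M *\<^sub>v c) \<bullet> (A *\<^sub>v (M *\<^sub>v c)) < 0"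
  shows "k \<le> neg_eigenvalue_count A"
proof (rule ccontr)
  assume less: "\<not> k \<le> neg_eigenvalue_count A"
  obtain L \<beta> where L: "L \<in> carrier_mat n n"
    and form: "\<forall>x \<in> carrier_vec n. x \<bullet> (A *\<^sub>v x) = (\<Sum>i<n. \<beta> i * ((L *\<^sub>v x) $ i)\<^sup>2)"
    and ker: "\<forall>x \<in> carrier_vec n. L *\<^sub>v x = 0\<^sub>v n \<longrightarrow> x = 0\<^sub>v n"
    and cnt: "neg_eigenvalue_count A = card {i. i < n \<and> \<beta> i < 0}"
    using quadratic_form_sum_of_squares[OF A] by blast
  have LM: "L * M \<in> carrier_mat n k" using L M by simp
  from less cnt have "card {i. i < n \<and> \<beta> i < 0} < k" by simp
  with underdetermined_system_solution[OF LM, of "{i. i < n \<and> \<beta> i < 0}"] obtain c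
    where c: "c \<in> carrier_vec k" "c \<noteq> 0\<^sub>v k"
      and 0: "\<And>i. i < n \<Longrightarrow> \<beta> i < 0 \<Longrightarrow> ((L * M) *\<^sub>v c) $ i = 0" by auto
  have x: "M *\<^sub>v c \<in> carrier_vec n" using M c by simp
  have "(L * M) *\<^sub>v c = L *\<^sub>v (M *\<^sub>v c)" using L M c by simp
  with 0 have "((L *\<^sub>v (M *\<^sub>v c)) $ i) = 0" if "i < n" "\<beta> i < 0" for i using that by simp
  then have "\<beta> i * ((L *\<^sub>v (M *\<^sub>v c)) $ i)\<^sup>2 \<ge> 0" if "i < n" for i
    using that by (cases "\<beta> i < 0") auto
  then have "0 \<le> (\<Sum>i<n. \<beta> i * ((L *\<^sub>v (M *\<^sub>v c)) $ i)\<^sup>2)"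
    by (intro sum_nonneg) simp
  then show False using neg[OF c] bspec[OF form x] by simp
qed

text \<open>The other half: were \<open>m\<close> larger than the number of nonnegative eigenvalues,
  a nonzero vector of the subspace would have coordinates at negative eigenvalues only, and
  nonnegativity of the form kills those too.\<close>

lemma neg_eigenvalue_count_le:
  fixes A :: "real mat"
  assumes A: "A \<in> carrier_mat n n" "A\<^sup>T = A" and M: "M \<in> carrier_mat n m"
    and inj: "\<And>c. c \<in> carrier_vec m \<Longrightarrow> M *\<^sub>v c = 0\<^sub>v n \<Longrightarrow> c = 0\<^sub>v m"
    and nonneg: "\<And>c. c \<in> carrier_vec m \<Longrightarrow> (M *\<^sub>v c) \<bullet> (A *\<^sub>v (M *\<^sub>v c)) \<ge> 0"
  shows "neg_eigenvalue_count A + m \<le> n"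
proof (rule ccontr)
  assume less: "\<not> neg_eigenvalue_count A + m \<le> n"
  obtain L \<beta> where L: "L \<in> carrier_mat n n"
    and form: "\<forall>x \<in> carrier_vec n. x \<bullet> (A *\<^sub>v x) = (\<Sum>i<n. \<beta> i * ((L *\<^sub>v x) $ i)\<^sup>2)"
    and ker: "\<forall>x \<in> carrier_vec n. L *\<^sub>v x = 0\<^sub>v n \<longrightarrow> x = 0\<^sub>v n"
    and cnt: "neg_eigenvalue_count A = card {i. i < n \<and> \<beta> i < 0}"
    using quadratic_form_sum_of_squares[OF A] by blast
  have LM: "L * M \<in> carrier_mat n m" using L M by simp
  let ?I = "{i. i < n \<and> \<not> \<beta> i < 0}"
  have "?I = {..<n} - {i. i < n \<and> \<beta> i < 0}" by auto
  then have "card ?I = n - neg_eigenvalue_count A"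
    unfolding cnt by (simp add: card_Diff_subset subset_eq)
  moreover have "neg_eigenvalue_count A \<le> n"
    unfolding cnt using card_mono[of "{..<n}" "{i. i < n \<and> \<beta> i < 0}"] by auto
  ultimately have "card ?I < m" using less by simp
  with underdetermined_system_solution[OF LM, of ?I] obtain c
    where c: "c \<in> carrier_vec m" "c \<noteq> 0\<^sub>v m"
      and 0: "\<And>i. i < n \<Longrightarrow> \<not> \<beta> i < 0 \<Longrightarrow> ((L * M) *\<^sub>v c) $ i = 0" by auto
  have x: "M *\<^sub>v c \<in> carrier_vec n" using M c by simp
  define y where "y = L *\<^sub>v (M *\<^sub>v c)"
  have yc: "y \<in> carrier_vec n" using L x by (simp add: y_def)
  have "(L * M) *\<^sub>v c = y" unfolding y_def using L M c by simp
  note 0 = 0[unfolded this]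
  have "0 \<le> (\<Sum>i<n. \<beta> i * (y $ i)\<^sup>2)" using nonneg[OF c(1)] bspec[OF form x] by (simp add: y_def)
  moreover have np: "\<beta> i * (y $ i)\<^sup>2 \<le> 0" if "i < n" for i
    using 0[OF that] by (cases "\<beta> i < 0") (auto simp: mult_nonpos_nonneg)
  ultimately have "(\<Sum>i<n. - (\<beta> i * (y $ i)\<^sup>2)) = 0"
    by (intro antisym sum_nonneg) (auto simp: sum_negf)
  then have "\<beta> i * (y $ i)\<^sup>2 = 0" if "i < n" for i
    using sum_nonneg_eq_0_iff[of "{..<n}" "\<lambda>i. - (\<beta> i * (y $ i)\<^sup>2)"] np that by auto
  \<comment> \<open>Where \<open>\<beta> i < 0\<close> the vanishing product forces this; elsewhere
    it holds by the choice of \<open>c\<close>.\<close>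
  then have "y $ i = 0" if "i < n" for i using 0[OF that] that by fastforce
  then have "y = 0\<^sub>v n" using yc by auto
  then have "M *\<^sub>v c = 0\<^sub>v n" using ker x by (simp add: y_def)
  then show False using inj[OF c(1)] c(2) by simp
qed

section \<open>Leaf sequences\<close>

text \<open>Pairs of a leaf and its neighbour, in order of deletion. Only adjacency to vertices of
  later pairs is restricted: the list takes apart an induced subgraph, not the whole graph. For
  symmetric \<open>E\<close> the conditions make all listed vertices distinct.\<close>

definition leaf_seq :: "('v \<Rightarrow> 'v \<Rightarrow> bool) \<Rightarrow> ('v \<times> 'v) list \<Rightarrow> bool" where
  "leaf_seq E ps \<longleftrightarrow> sorted_wrt (\<lambda>(y, x) (y', x'). \<not> E y y' \<and> \<not> E y x') ps
    \<and> (\<forall>(y, x) \<in> set ps. E y x \<and> \<not> E y y)"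

lemma leaf_seq_Nil [simp]: "leaf_seq E []"
  by (simp add: leaf_seq_def)

lemma leaf_seq_Cons: "leaf_seq E ((y, x) # ps) \<longleftrightarrow>
    E y x \<and> \<not> E y y \<and> (\<forall>v \<in> fst ` set ps \<union> snd ` set ps. \<not> E y v) \<and> leaf_seq E ps"
  by (auto simp: leaf_seq_def case_prod_beta)

lemma leaf_seq_append: "leaf_seq E (ps @ qs) \<longleftrightarrow> leaf_seq E ps \<and> leaf_seq E qs
    \<and> (\<forall>y \<in> fst ` set ps. \<forall>v \<in> fst ` set qs \<union> snd ` set qs. \<not> E y v)"
  by (simp add: leaf_seq_def sorted_wrt_append case_prod_beta ball_Un) blast

lemma leaf_seq_map:
  assumes "leaf_seq E ps" and "set ps \<subseteq> S \<times> S"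
    and "\<And>s t. s \<in> S \<Longrightarrow> t \<in> S \<Longrightarrow> E' (h s) (h t) \<longleftrightarrow> E s t"
  shows "leaf_seq E' (map (map_prod h h) ps)"
  using assms(1,2)
proof (induction ps)
  case (Cons p ps)
  obtain y x where p: "p = (y, x)" by (cases p)
  have S: "y \<in> S" "x \<in> S" "v \<in> fst ` set ps \<union> snd ` set ps \<Longrightarrow> v \<in> S" for v
    using Cons.prems(2) p by auto
  have "\<not> E' (h y) v"
    if "v \<in> fst ` set (map (map_prod h h) ps) \<union> snd ` set (map (map_prod h h) ps)" for v
  proof -
    from that obtain u where u: "v = h u" "u \<in> fst ` set ps \<union> snd ` set ps" by force
    then show ?thesis using Cons.prems(1) p assms(3)[OF S(1) S(3)[OF u(2)]] by (simp add: leaf_seq_Cons)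
  qed
  then show ?case using Cons p assms(3)[OF S(1,2)] assms(3)[OF S(1,1)] by (simp add: leaf_seq_Cons)
qed simp

section \<open>The quadratic form on functions of the vertices\<close>

definition quad :: "'v set \<Rightarrow> ('v \<Rightarrow> 'v \<Rightarrow> real) \<Rightarrow> ('v \<Rightarrow> real) \<Rightarrow> real" where
  "quad V a f = (\<Sum>s\<in>V. f s * (\<Sum>t\<in>V. a s t * f t))"

text \<open>Expansion of the form around \<open>U\<close> along the unit vectors at \<open>x\<close>
  and \<open>y\<close>; the linear terms are the rows of \<open>a\<close> at \<open>x\<close> and
  \<open>y\<close> applied to \<open>U\<close>.\<close>

lemma quad_add_two_units:
  assumes fin: "finite V" and sym: "\<And>s t. a s t = a t s" and x: "x \<in> V" and y: "y \<in> V"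
  shows "quad V a (\<lambda>v. U v + p * of_bool (v = x) + r * of_bool (v = y)) =
    quad V a U + 2 * p * (\<Sum>t\<in>V. a x t * U t) + 2 * r * (\<Sum>t\<in>V. a y t * U t)
    + p\<^sup>2 * a x x + r\<^sup>2 * a y y + 2 * p * r * a y x"
proof -
  let ?row = "\<lambda>s. \<Sum>t\<in>V. a s t * U t"
  have d: "(\<Sum>s\<in>V. h s * of_bool (s = z)) = h z" if "z \<in> V" for z and h :: "'a \<Rightarrow> real"
    using sum.delta[OF fin, of z h] that by (simp add: of_bool_def if_distrib cong: if_cong)
  have d': "(\<Sum>s\<in>V. of_bool (s = z) * h s) = h z" if "z \<in> V" for z and h :: "'a \<Rightarrow> real"
    using d[OF that, of h] by (simp add: mult.commute)
  have row: "(\<Sum>t\<in>V. a s t * (U t + p * of_bool (t = x) + r * of_bool (t = y)))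
      = ?row s + p * a s x + r * a s y" for s
    using d[OF x, of "\<lambda>t. p * a s t"] d[OF y, of "\<lambda>t. r * a s t"]
    by (simp add: distrib_left sum.distrib mult.assoc mult.left_commute)
  have "quad V a (\<lambda>v. U v + p * of_bool (v = x) + r * of_bool (v = y)) =
      (\<Sum>s\<in>V. (U s + p * of_bool (s = x) + r * of_bool (s = y)) * (?row s + p * a s x + r * a s y))"
    unfolding quad_def row ..
  also have "\<dots> = (\<Sum>s\<in>V. U s * ?row s + p * (a x s * U s) + r * (a y s * U s)
      + p * (of_bool (s = x) * (?row s + p * a s x + r * a s y))
      + r * (of_bool (s = y) * (?row s + p * a s x + r * a s y)))"
    by (intro sum.cong refl) (simp only: sym[of x] sym[of y], simp only: algebra_simps)
  also have "\<dots> = quad V a U + p * ?row x + r * ?row y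
      + p * (?row x + p * a x x + r * a x y) + r * (?row y + p * a y x + r * a y y)"
    by (simp only: sum.distrib sum_distrib_left[symmetric] d'[OF x] d'[OF y] quad_def)
  finally show ?thesis using sym[of x y] by (simp add: algebra_simps power2_eq_square)
qed

text \<open>A pair \<open>(y, x)\<close> spans a hyperbolic plane; subtracting multiples of the unit vector at \<open>y\<close> makes
  the later vectors orthogonal to it without changing the form on them.\<close>

lemma leaf_seq_negative_definite:
  assumes fin: "finite V" and sym: "\<And>s t. a s t = a t s"
    and pos: "\<And>s t. E s t \<Longrightarrow> a s t > 0" and zero: "\<And>s t. \<not> E s t \<Longrightarrow> a s t = 0"
    and irr: "\<And>s. \<not> E s s"
    and "leaf_seq E ps" and "set ps \<subseteq> V \<times> V"
  shows "\<exists>f. (\<forall>i < length ps. \<forall>v. f i v \<noteq> 0 \<longrightarrow> v \<in> fst ` set ps \<union> snd ` set ps) \<and>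
    (\<forall>c. (\<exists>i < length ps. c i \<noteq> 0) \<longrightarrow> quad V a (\<lambda>v. \<Sum>i<length ps. c i * f i v) < 0)"
  using assms(6,7)
proof (induction ps)
  case (Cons p ps)
  obtain y x where p: "p = (y, x)" by (cases p)
  let ?k = "length ps"
  from Cons.prems p have yx: "E y x" and nadj: "\<And>v. v \<in> fst ` set ps \<union> snd ` set ps \<Longrightarrow> \<not> E y v"
    and V: "y \<in> V" "x \<in> V" and rest: "leaf_seq E ps" "set ps \<subseteq> V \<times> V"
    by (auto simp: leaf_seq_Cons)
  from Cons.IH[OF rest] obtain f where
    supp: "\<And>i v. i < ?k \<Longrightarrow> f i v \<noteq> 0 \<Longrightarrow> v \<in> fst ` set ps \<union> snd ` set ps" and
    neg: "\<And>c. \<exists>i < ?k. c i \<noteq> 0 \<Longrightarrow> quad V a (\<lambda>v. \<Sum>i<?k. c i * f i v) < 0" by blast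
  define w where "w = a y x"
  have w: "w > 0" unfolding w_def using pos yx by simp
  \<comment> \<open>\<open>b i\<close> is chosen so that \<open>f i\<close> minus \<open>b i\<close>
    times the unit vector at \<open>y\<close> is orthogonal to the unit vector at
    \<open>x\<close>.\<close>
  define b where "b = (\<lambda>i. (\<Sum>t\<in>V. a x t * f i t) / w)"
  \<comment> \<open>The new last vector, the unit at \<open>x\<close> minus the unit at
    \<open>y\<close>, has form value \<open>- 2 * w\<close>.\<close>
  define g where "g = (\<lambda>i v. if i < ?k then f i v - b i * of_bool (v = y)
    else of_bool (v = x) - of_bool (v = y))"
  have "g i v \<noteq> 0 \<longrightarrow> v \<in> fst ` set (p # ps) \<union> snd ` set (p # ps)" if "i < length (p # ps)" for i v
    using supp[of i v] that unfolding g_def p by (auto split: if_splits)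
  moreover have "quad V a (\<lambda>v. \<Sum>i<length (p # ps). c i * g i v) < 0"
    if c: "\<exists>i < length (p # ps). c i \<noteq> 0" for c
  proof -
    define U where "U = (\<lambda>v. \<Sum>i<?k. c i * f i v)"
    define \<beta> where "\<beta> = (\<Sum>i<?k. c i * b i)"
    have eq: "(\<lambda>v. \<Sum>i<length (p # ps). c i * g i v) =
      (\<lambda>v. U v + c ?k * of_bool (v = x) + (- \<beta> - c ?k) * of_bool (v = y))"
      by (rule ext) (simp add: g_def U_def \<beta>_def algebra_simps sum_subtractf sum_distrib_left sum_distrib_right)
    \<comment> \<open>\<open>U\<close> lives on the vertices of later pairs, none of which is
      adjacent to \<open>y\<close>.\<close>
    have "a y t * U t = 0" for t
    proof (cases "E y t")
      case True
      then have "f i t = 0" if "i < ?k" for i using supp[OF that, of t] nadj by blast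
      then show ?thesis by (simp add: U_def)
    qed (simp add: zero)
    then have rowy: "(\<Sum>t\<in>V. a y t * U t) = 0" by simp
    have "(\<Sum>t\<in>V. a x t * U t) = (\<Sum>t\<in>V. \<Sum>i<?k. c i * (a x t * f i t))"
      unfolding U_def sum_distrib_left by (intro sum.cong refl) (simp add: algebra_simps)
    also have "\<dots> = (\<Sum>i<?k. c i * (\<Sum>t\<in>V. a x t * f i t))"
      by (subst sum.swap) (simp add: sum_distrib_left)
    also have "\<dots> = \<beta> * w"
      unfolding \<beta>_def b_def sum_distrib_right using w by simp
    finally have rowx: "(\<Sum>t\<in>V. a x t * U t) = \<beta> * w" .
    \<comment> \<open>The terms \<open>2 * c ?k * \<beta> * w\<close> from the row of
      \<open>x\<close> and from the product of the two unit coefficients cancel.\<close>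
    have "quad V a (\<lambda>v. \<Sum>i<length (p # ps). c i * g i v) = quad V a U - 2 * w * (c ?k)\<^sup>2"
      unfolding eq quad_add_two_units[OF fin sym V(2,1)] rowx rowy
      using zero[OF irr[of x]] zero[OF irr[of y]] by (simp add: w_def algebra_simps power2_eq_square)
    moreover have "quad V a U < 0 \<or> quad V a U = 0 \<and> c ?k \<noteq> 0"
    proof (cases "\<exists>i < ?k. c i \<noteq> 0")
      case True
      then show ?thesis using neg unfolding U_def by blast
    next
      case False
      then have "U = (\<lambda>_. 0)" unfolding U_def by (intro ext) simp
      then show ?thesis using False c less_Suc_eq by (auto simp: quad_def)
    qed
    moreover have "0 \<le> w * (c ?k)\<^sup>2" "c ?k \<noteq> 0 \<Longrightarrow> 0 < w * (c ?k)\<^sup>2" using w by simp_all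
    ultimately show ?thesis by linarith
  qed
  ultimately show ?case by blast
qed simp

section \<open>Passage from vertex functions to the weighted adjacency matrix\<close>

definition adj_weight :: "'a pair_pre_digraph \<Rightarrow> ('a \<times> 'a) weight_fun \<Rightarrow> 'a \<Rightarrow> 'a \<Rightarrow> real" where
  "adj_weight G w s t = (if (s, t) \<in> parcs G then w (s, t) else 0)"

lemma quad_weighted_adj_mat:
  assumes dist: "distinct vs"
  defines "n \<equiv> length vs"
  shows "vec n (\<lambda>i. f (vs ! i)) \<bullet> (weighted_adj_mat vs G w *\<^sub>v vec n (\<lambda>i. f (vs ! i))) =
    quad (set vs) (adj_weight G w) f"
proof -
  have bij: "bij_betw ((!) vs) {0..<n} (set vs)"
    using bij_betw_nth[OF dist] by (simp add: n_def atLeast0LessThan)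
  have re: "(\<Sum>s\<in>set vs. h s) = (\<Sum>i=0..<n. h (vs ! i))" for h :: "'a \<Rightarrow> real"
    using sum.reindex_bij_betw[OF bij, of h] by simp
  have "(weighted_adj_mat vs G w *\<^sub>v vec n (\<lambda>i. f (vs ! i))) $ i =
      (\<Sum>t\<in>set vs. adj_weight G w (vs ! i) t * f t)" if "i < n" for i
    using that unfolding re by (simp add: weighted_adj_mat_def scalar_prod_def n_def adj_weight_def)
  then show ?thesis
    unfolding quad_def re[of "\<lambda>s. f s * _ s"]
    by (simp add: scalar_prod_def weighted_adj_mat_def n_def[symmetric])
qed

lemma mat_mult_vec_combination:
  fixes f :: "nat \<Rightarrow> 'v \<Rightarrow> 'r :: comm_semiring_0"
  assumes "c \<in> carrier_vec k"
  shows "mat n k (\<lambda>(i, j). f j (vs ! i)) *\<^sub>v c = vec n (\<lambda>i. \<Sum>j<k. c $ j * f j (vs ! i))"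
  using assms by (intro eq_vecI) (auto simp: scalar_prod_def lessThan_atLeast0 mult.commute intro!: sum.cong)

context
  fixes G :: "'a pair_pre_digraph" and w :: "('a \<times> 'a) weight_fun"
  assumes graph: "pair_graph G" and weights: "weighting G w"
begin

interpretation pair_graph G by (rule graph)

lemma adj_weight_sym: "adj_weight G w s t = adj_weight G w t s"
  using weights arcs_symmetric by (fastforce simp: adj_weight_def weighting_def)

lemma weighted_adj_mat_transpose: "(weighted_adj_mat vs G w)\<^sup>T = weighted_adj_mat vs G w"
  using adj_weight_sym by (intro eq_matI) (auto simp: weighted_adj_mat_def adj_weight_def)

lemma neg_inertia_enumeration:
  obtains vs where "distinct vs" "set vs = pverts G"
    "neg_inertia G w = neg_eigenvalue_count (weighted_adj_mat vs G w)"
proof -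
  let ?P = "\<lambda>vs. distinct vs \<and> set vs = pverts G"
  have "\<exists>vs. ?P vs" using finite_distinct_list[OF pair_finite_verts] by blast
  then have "?P (SOME vs. ?P vs)" by (rule someI_ex)
  then show ?thesis using that unfolding neg_inertia_def by blast
qed

text \<open>The functions attached to the leaf sequence, read along the enumeration, become the
  columns of a matrix on whose nonzero combinations the form is negative.\<close>

lemma neg_inertia_ge_leaf_seq:
  assumes ps: "leaf_seq (\<lambda>s t. (s, t) \<in> parcs G) ps" and "set ps \<subseteq> pverts G \<times> pverts G"
  shows "length ps \<le> neg_inertia G w"
proof -
  let ?k = "length ps"
  obtain vs where vs: "distinct vs" "set vs = pverts G"
    and inertia: "neg_inertia G w = neg_eigenvalue_count (weighted_adj_mat vs G w)"
    by (rule neg_inertia_enumeration)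
  have "\<exists>f. (\<forall>i < ?k. \<forall>v. f i v \<noteq> 0 \<longrightarrow> v \<in> fst ` set ps \<union> snd ` set ps) \<and>
    (\<forall>c. (\<exists>i < ?k. c i \<noteq> 0) \<longrightarrow> quad (pverts G) (adj_weight G w) (\<lambda>v. \<Sum>i<?k. c i * f i v) < 0)"
  proof (rule leaf_seq_negative_definite[OF pair_finite_verts adj_weight_sym _ _ _ ps assms(2)])
    show "(s, t) \<in> parcs G \<Longrightarrow> 0 < adj_weight G w s t" for s t
      using weights by (auto simp: adj_weight_def weighting_def)
    show "(s, s) \<notin> parcs G" for s using no_loops' by blast
  qed (simp add: adj_weight_def)
  then obtain f where
    f: "\<And>c. \<exists>i < ?k. c i \<noteq> 0 \<Longrightarrow> quad (pverts G) (adj_weight G w) (\<lambda>v. \<Sum>i<?k. c i * f i v) < 0"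
    by blast
  let ?n = "length vs"
  show ?thesis unfolding inertia
  proof (rule neg_eigenvalue_count_ge)
    show "weighted_adj_mat vs G w \<in> carrier_mat ?n ?n" by (simp add: weighted_adj_mat_def)
    show "(weighted_adj_mat vs G w)\<^sup>T = weighted_adj_mat vs G w" by (rule weighted_adj_mat_transpose)
    show "mat ?n ?k (\<lambda>(i, j). f j (vs ! i)) \<in> carrier_mat ?n ?k" by simp
    fix c :: "real vec" assume c: "c \<in> carrier_vec ?k" "c \<noteq> 0\<^sub>v ?k"
    then have "\<exists>i < ?k. c $ i \<noteq> 0" by (metis carrier_vecD eq_vecI index_zero_vec)
    from f[OF this] show "(mat ?n ?k (\<lambda>(i, j). f j (vs ! i)) *\<^sub>v c) \<bullet>
        (weighted_adj_mat vs G w *\<^sub>v (mat ?n ?k (\<lambda>(i, j). f j (vs ! i)) *\<^sub>v c)) < 0"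
      unfolding mat_mult_vec_combination[OF c(1)]
      using quad_weighted_adj_mat[OF vs(1), of "\<lambda>v. \<Sum>j<?k. c $ j * f j v" G w] vs(2) by simp
  qed
qed

text \<open>The unit vectors at the vertices of \<open>R\<close> span a totally isotropic subspace
  of dimension \<open>card R\<close>, whatever the weights.\<close>

lemma neg_inertia_le_independent:
  assumes R: "R \<subseteq> pverts G" and ind: "\<And>s t. s \<in> R \<Longrightarrow> t \<in> R \<Longrightarrow> (s, t) \<notin> parcs G"
  shows "neg_inertia G w + card R \<le> card (pverts G)"
proof -
  obtain vs where vs: "distinct vs" "set vs = pverts G"
    and inertia: "neg_inertia G w = neg_eigenvalue_count (weighted_adj_mat vs G w)"
    by (rule neg_inertia_enumeration)
  obtain rs where rs: "distinct rs" "set rs = R"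
    using finite_distinct_list R pair_finite_verts finite_subset by metis
  let ?n = "length vs" and ?m = "length rs"
  define f where "f = (\<lambda>j v. of_bool (v = rs ! j) :: real)"
  have "neg_eigenvalue_count (weighted_adj_mat vs G w) + ?m \<le> ?n"
  proof (rule neg_eigenvalue_count_le)
    show "weighted_adj_mat vs G w \<in> carrier_mat ?n ?n" by (simp add: weighted_adj_mat_def)
    show "(weighted_adj_mat vs G w)\<^sup>T = weighted_adj_mat vs G w" by (rule weighted_adj_mat_transpose)
    show "mat ?n ?m (\<lambda>(i, j). f j (vs ! i)) \<in> carrier_mat ?n ?m" by simp
    fix c :: "real vec" assume c: "c \<in> carrier_vec ?m"
    let ?F = "\<lambda>v. \<Sum>j<?m. c $ j * f j v"
    have "?F s * (adj_weight G w s t * ?F t) = 0" for s t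
    proof (cases "s \<in> R \<and> t \<in> R")
      case True
      then show ?thesis using ind by (simp add: adj_weight_def)
    next
      case False
      then have "?F s = 0 \<or> ?F t = 0" using rs(2) by (auto simp: f_def intro!: sum.neutral)
      then show ?thesis by auto
    qed
    then have "quad (set vs) (adj_weight G w) ?F = 0"
      by (simp add: quad_def sum_distrib_left)
    then show "(mat ?n ?m (\<lambda>(i, j). f j (vs ! i)) *\<^sub>v c) \<bullet>
        (weighted_adj_mat vs G w *\<^sub>v (mat ?n ?m (\<lambda>(i, j). f j (vs ! i)) *\<^sub>v c)) \<ge> 0"
      unfolding mat_mult_vec_combination[OF c]
      using quad_weighted_adj_mat[OF vs(1), of ?F G w] by simp
    assume eq: "mat ?n ?m (\<lambda>(i, j). f j (vs ! i)) *\<^sub>v c = 0\<^sub>v ?n"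
    have 0: "?F (vs ! i) = 0" if "i < ?n" for i
      using arg_cong[OF eq[unfolded mat_mult_vec_combination[OF c]], of "\<lambda>v. v $ i"] that by simp
    have "c $ j = 0" if j: "j < ?m" for j
    proof -
      have "rs ! j \<in> set vs" using j rs(2) R vs(2) nth_mem by blast
      then obtain i where i: "i < ?n" "vs ! i = rs ! j" by (auto simp: in_set_conv_nth)
      \<comment> \<open>The value at the vertex \<open>rs ! j\<close> recovers \<open>c $ j\<close>,
        which gives injectivity.\<close>
      have "?F (rs ! j) = (\<Sum>j'<?m. if j' = j then c $ j' else 0)"
        using rs(1) j by (intro sum.cong) (auto simp: f_def nth_eq_iff_index_eq)
      also have "\<dots> = c $ j" using j by simp
      finally show ?thesis using 0[OF i(1)] i(2) by simp
    qed
    then show "c = 0\<^sub>v ?m" using c by auto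
  qed
  moreover have "?n = card (pverts G)" "?m = card R" using vs rs distinct_card by metis+
  ultimately show ?thesis using inertia by simp
qed

end

section \<open>Leaf sequences avoiding a vertex of the base\<close>

text \<open>Orienting all pairs towards one end of the path keeps any prescribed vertex \<open>\<pi> j\<close> from
  being a leaf; the parity of \<open>j\<close> decides which end.\<close>

lemma path_leaf_seq:
  fixes \<pi> :: "nat \<Rightarrow> 'v"
  assumes adj: "\<And>i k. i \<in> {1..m} \<Longrightarrow> k \<in> {1..m} \<Longrightarrow> E (\<pi> i) (\<pi> k) \<longleftrightarrow> k = Suc i \<or> i = Suc k"
  shows "\<exists>ps. leaf_seq E ps \<and> length ps = m div 2 \<and>
    fst ` set ps \<subseteq> \<pi> ` ({1..m} - {j}) \<and> snd ` set ps \<subseteq> \<pi> ` {1..m}"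
proof (cases "even j")
  case True
  let ?ps = "map (\<lambda>i. (\<pi> (2*i + 1), \<pi> (2*i + 2))) [0..<m div 2]"
  have "sorted_wrt (\<lambda>i k. \<not> E (\<pi> (2*i + 1)) (\<pi> (2*k + 1)) \<and> \<not> E (\<pi> (2*i + 1)) (\<pi> (2*k + 2))) [0..<m div 2]"
    by (rule sorted_wrt_mono_rel[OF _ sorted_wrt_upt]) (auto simp: adj)
  then have "leaf_seq E ?ps" by (auto simp: leaf_seq_def sorted_wrt_map adj)
  moreover have "2*i + 1 \<noteq> j" for i using True by auto
  then have "fst ` set ?ps \<subseteq> \<pi> ` ({1..m} - {j})" "snd ` set ?ps \<subseteq> \<pi> ` {1..m}" by auto
  ultimately show ?thesis by (intro exI[of _ ?ps]) simp
next
  case False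
  \<comment> \<open>For odd \<open>j\<close> the leaves are the even positions, deleted from the far
    end downwards, hence \<open>rev\<close>.\<close>
  let ?ps = "map (\<lambda>i. (\<pi> (2*i + 2), \<pi> (2*i + 1))) (rev [0..<m div 2])"
  have "sorted_wrt (\<lambda>i k. \<not> E (\<pi> (2*k + 2)) (\<pi> (2*i + 2)) \<and> \<not> E (\<pi> (2*k + 2)) (\<pi> (2*i + 1))) [0..<m div 2]"
    by (rule sorted_wrt_mono_rel[OF _ sorted_wrt_upt]) (auto simp: adj)
  then have "leaf_seq E ?ps" by (auto simp: leaf_seq_def sorted_wrt_map sorted_wrt_rev adj)
  moreover have "2*i + 2 \<noteq> j" for i using False by auto
  then have "fst ` set ?ps \<subseteq> \<pi> ` ({1..m} - {j})" "snd ` set ?ps \<subseteq> \<pi> ` {1..m}" by auto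
  ultimately show ?thesis by (intro exI[of _ ?ps]) simp
qed

text \<open>The equivalence makes the cycle induced: leaf sequences rely on the absence of
  chords.\<close>

definition cycle_in :: "('v \<Rightarrow> 'v \<Rightarrow> bool) \<Rightarrow> nat \<Rightarrow> (nat \<Rightarrow> 'v) \<Rightarrow> bool" where
  "cycle_in E p c \<longleftrightarrow> inj_on c {..<p} \<and>
    (\<forall>i<p. \<forall>k<p. E (c i) (c k) \<longleftrightarrow> k = Suc i mod p \<or> i = Suc k mod p)"

text \<open>Without \<open>c r\<close> the cycle is a path with \<open>p - 1\<close> vertices. The
  vertex \<open>c 0\<close> sits at position \<open>p - r\<close> of it and is the one kept from
  being a leaf; for \<open>r = 0\<close> that position is beyond the end.\<close>

lemma cycle_minus_vertex_leaf_seq: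
  assumes cyc: "cycle_in E p c" and r: "r < p"
  shows "\<exists>ps. leaf_seq E ps \<and> length ps = (p - 1) div 2 \<and>
    fst ` set ps \<subseteq> c ` ({..<p} - {0, r}) \<and> snd ` set ps \<subseteq> c ` ({..<p} - {r})"
proof -
  let ?\<pi> = "\<lambda>i. c ((r + i) mod p)"
  have step: "(r + k) mod p = Suc ((r + i) mod p) mod p \<longleftrightarrow> k = Suc i"
    if "i \<in> {1..p - 1}" "k \<in> {1..p - 1}" for i k
  proof
    assume "(r + k) mod p = Suc ((r + i) mod p) mod p"
    then have "(r + k) mod p = (r + Suc i) mod p" by (simp add: mod_Suc_eq)
    \<comment> \<open>Both sums stay below \<open>2 * p\<close>, so reduction subtracts
      \<open>p\<close> at most once.\<close>
    moreover have "x mod p = (if x < p then x else x - p)" if "x < 2 * p" for x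
      using that by (simp add: mod_if)
    ultimately show "k = Suc i" using that r by (auto split: if_splits)
  qed (simp add: mod_Suc_eq)
  have adj: "E (?\<pi> i) (?\<pi> k) \<longleftrightarrow> k = Suc i \<or> i = Suc k"
    if "i \<in> {1..p - 1}" "k \<in> {1..p - 1}" for i k
    using cyc step[OF that] step[OF that(2,1)] r by (simp add: cycle_in_def)
  from path_leaf_seq[of "p - 1" E ?\<pi>, OF adj] obtain ps where
    ps: "leaf_seq E ps" "length ps = (p - 1) div 2" "fst ` set ps \<subseteq> ?\<pi> ` ({1..p - 1} - {p - r})"
      "snd ` set ps \<subseteq> ?\<pi> ` {1..p - 1}" by blast
  have nr: "(r + i) mod p \<noteq> r" if "i \<in> {1..p - 1}" for i
    using that r by (cases "r + i < p") (auto simp: mod_if)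
  have n0: "(r + i) mod p \<noteq> 0" if "i \<in> {1..p - 1}" "i \<noteq> p - r" for i
    using that r by (cases "r + i < p") (auto simp: mod_if)
  have "(r + i) mod p < p" for i using r by simp
  then have "?\<pi> ` ({1..p - 1} - {p - r}) \<subseteq> c ` ({..<p} - {0, r})"
    using nr n0 by (intro image_subsetI imageI) simp
  moreover have "?\<pi> ` {1..p - 1} \<subseteq> c ` ({..<p} - {r})"
    using nr \<open>\<And>i. (r + i) mod p < p\<close> by (intro image_subsetI imageI) simp
  ultimately show ?thesis using ps by (meson subset_trans)
qed

text \<open>The first cycle, opened at \<open>c r\<close>, is eliminated before the second one, opened at its
  attachment vertex \<open>d 0\<close>; this is legitimate since \<open>c 0\<close>, the only vertex of the first cycle
  that may have neighbours among the \<open>d j\<close>, is not used as a leaf.\<close>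

lemma two_cycles_leaf_seq:
  assumes cyc: "cycle_in E p c" "cycle_in E q d" and q: "0 < q"
    and disj: "\<And>i j. i < p \<Longrightarrow> 0 < j \<Longrightarrow> j < q \<Longrightarrow> c i \<noteq> d j"
    and nadj: "\<And>i j. 0 < i \<Longrightarrow> i < p \<Longrightarrow> 0 < j \<Longrightarrow> j < q \<Longrightarrow> \<not> E (c i) (d j)"
    and r: "r < p"
  shows "\<exists>ps. leaf_seq E ps \<and> length ps = (p - 1) div 2 + (q - 1) div 2 \<and>
    fst ` set ps \<union> snd ` set ps \<subseteq> c ` {..<p} \<union> d ` {..<q} - {c r}"
proof -
  from cycle_minus_vertex_leaf_seq[OF cyc(1) r] obtain ps where
    ps: "leaf_seq E ps" "length ps = (p - 1) div 2"
      "fst ` set ps \<subseteq> c ` ({..<p} - {0, r})" "snd ` set ps \<subseteq> c ` ({..<p} - {r})" by blast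
  from cycle_minus_vertex_leaf_seq[OF cyc(2) q] obtain qs where
    qs: "leaf_seq E qs" "length qs = (q - 1) div 2"
      "fst ` set qs \<subseteq> d ` ({..<q} - {0})" "snd ` set qs \<subseteq> d ` ({..<q} - {0})" by auto
  have "\<not> E y v" if "y \<in> fst ` set ps" "v \<in> fst ` set qs \<union> snd ` set qs" for y v
  proof -
    from that(1) ps(3) obtain i where i: "y = c i" "0 < i" "i < p" by blast
    from that(2) qs(3,4) obtain j where j: "v = d j" "0 < j" "j < q" by blast
    show ?thesis unfolding i j using nadj i j by blast
  qed
  then have leaf: "leaf_seq E (ps @ qs)" using ps qs by (simp add: leaf_seq_append)
  let ?S = "c ` {..<p} \<union> d ` {..<q} - {c r}"
  have "c ` ({..<p} - {r}) \<subseteq> ?S"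
  proof (rule image_subsetI)
    fix i assume "i \<in> {..<p} - {r}"
    then show "c i \<in> ?S" using cyc(1) r by (auto simp: cycle_in_def inj_on_def)
  qed
  moreover have "d ` ({..<q} - {0}) \<subseteq> ?S"
  proof (rule image_subsetI)
    fix j assume "j \<in> {..<q} - {0}"
    then show "d j \<in> ?S" using disj[OF r, of j] by simp
  qed
  moreover have "c ` ({..<p} - {0, r}) \<subseteq> c ` ({..<p} - {r})" by (rule image_mono) auto
  ultimately have "fst ` set (ps @ qs) \<union> snd ` set (ps @ qs) \<subseteq> ?S"
    using ps(3,4) qs(3,4) unfolding set_append image_Un by (meson Un_least subset_trans)
  with leaf ps(2) qs(2) show ?thesis by (intro exI[of _ "ps @ qs"]) simp
qed

section \<open>Adjacency in \<open>infinity_graph\<close> and its two cycles\<close>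

lemma mem_cycle_arcs_iff:
  "(s, t) \<in> cycle_arcs a k \<longleftrightarrow> a \<le> s \<and> s < a + k \<and> t = a + Suc (s - a) mod k"
  unfolding cycle_arcs_def by (auto intro!: exI[of _ "s - a"])

lemma mem_path_arcs_iff: "(s, t) \<in> path_arcs a k \<longleftrightarrow> a \<le> s \<and> Suc s < a + k \<and> t = Suc s"
  unfolding path_arcs_def by (auto intro!: exI[of _ "s - a"])

text \<open>One orientation of the edges, piece by piece in closed form; adjacency is its symmetric
  closure.\<close>

definition infinity_step :: "nat \<Rightarrow> nat \<Rightarrow> nat \<Rightarrow> nat \<Rightarrow> nat \<Rightarrow> bool" where
  "infinity_step p l q s t \<longleftrightarrow> s < p \<and> t = Suc s mod p \<or>
    p - 1 \<le> s \<and> Suc s < p - 1 + l \<and> t = Suc s \<or>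
    p + l - 2 \<le> s \<and> s < p + l - 2 + q \<and> t = p + l - 2 + Suc (s - (p + l - 2)) mod q"

lemma infinity_graph_adj:
  "(s, t) \<in> parcs (infinity_graph p l q) \<longleftrightarrow> infinity_step p l q s t \<or> infinity_step p l q t s"
proof -
  have "parcs (infinity_graph p l q) = (cycle_arcs 0 p \<union> path_arcs (p - 1) l \<union> cycle_arcs (p + l - 2) q)
      \<union> (cycle_arcs 0 p \<union> path_arcs (p - 1) l \<union> cycle_arcs (p + l - 2) q)\<inverse>"
    by (simp add: infinity_graph_def Let_def)
  then show ?thesis
    by (simp only: Un_iff converse_iff mem_path_arcs_iff mem_cycle_arcs_iff infinity_step_def
      add_0 diff_zero le0 simp_thms disj_assoc)
qed

context
  fixes p l q :: nat
  assumes pq: "p \<ge> 3" "q \<ge> 3" and l: "l \<ge> 1"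
begin

lemma infinity_graph_leaf_seq:
  "\<exists>ps. leaf_seq (\<lambda>s t. (s, t) \<in> parcs (infinity_graph p l q)) ps \<and>
    length ps = (p - 1) div 2 + (q - 1) div 2 \<and>
    set ps \<subseteq> (pverts (infinity_graph p l q) - {x}) \<times> (pverts (infinity_graph p l q) - {x})"
proof -
  let ?E = "\<lambda>s t. (s, t) \<in> parcs (infinity_graph p l q)"
  let ?V = "pverts (infinity_graph p l q)"
  have V: "?V = {0..<p + l + q - 2}" by (simp add: infinity_graph_def Let_def)
  \<comment> \<open>The numbering of the first cycle is rotated by one so that its attachment vertex
    \<open>p - 1\<close> becomes \<open>c 0\<close>.\<close>
  define c where "c = (\<lambda>i. if i = 0 then p - 1 else i - 1)"
  define d where "d = (\<lambda>j. p + l - 2 + j)"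
  have injc: "inj_on c {..<p}" by (auto simp: inj_on_def c_def split: if_splits)
  have cS: "c (Suc i mod p) = Suc (c i) mod p" if "i < p" for i
    using that pq by (auto simp: c_def mod_Suc)
  have cp: "c i < p" if "i < p" for i using that by (auto simp: c_def)
  have "?E s t \<longleftrightarrow> t = Suc s mod p \<or> s = Suc t mod p" if "s < p" "t < p" for s t
    using that pq l unfolding infinity_graph_adj infinity_step_def by (auto simp: mod_Suc split: if_splits)
  then have "?E (c i) (c k) \<longleftrightarrow> k = Suc i mod p \<or> i = Suc k mod p" if "i < p" "k < p" for i k
    using that pq inj_onD[OF injc, of k "Suc i mod p"] inj_onD[OF injc, of i "Suc k mod p"]
    by (auto simp: cp cS[symmetric])
  with injc have cyc_c: "cycle_in ?E p c" by (auto simp: cycle_in_def)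
  have step_d: "infinity_step p l q (d i) (d k) \<longleftrightarrow> k = Suc i mod q" if "i < q" "k < q" for i k
  proof -
    \<comment> \<open>A vertex \<open>d i\<close> below \<open>p\<close> occurs only for
      \<open>l = 1\<close> and \<open>i = 0\<close>, where it is \<open>p - 1\<close>; its successor
      on the first cycle is \<open>0\<close>, which is no \<open>d k\<close>.\<close>
    have "\<not> (d i < p \<and> d k = Suc (d i) mod p)"
    proof
      assume *: "d i < p \<and> d k = Suc (d i) mod p"
      then have "Suc (d i) = p" using pq l unfolding d_def by linarith
      with * have "d k = 0" by simp
      then show False using pq l unfolding d_def by linarith
    qed
    moreover have "\<not> Suc (d i) < p - 1 + l" using pq l by (simp add: d_def)
    ultimately show ?thesis using that by (auto simp: infinity_step_def d_def)
  qed
  then have "?E (d i) (d k) \<longleftrightarrow> k = Suc i mod q \<or> i = Suc k mod q" if "i < q" "k < q" for i k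
    using that unfolding infinity_graph_adj by blast
  then have cyc_d: "cycle_in ?E q d" by (auto simp: cycle_in_def d_def inj_on_def)
  have nadj: "\<not> ?E (c i) (d j)" "\<not> ?E (d j) (c i)" if "0 < i" "i < p" "0 < j" "j < q" for i j
  proof -
    have ci: "Suc (c i) < p" and dj: "p \<le> d j" using that pq l by (auto simp: c_def d_def)
    have "Suc a mod p < p" for a using pq by simp
    then have "\<not> infinity_step p l q (c i) (d j)" using ci dj l by (auto simp: infinity_step_def)
    moreover have "\<not> infinity_step p l q (d j) (c i)" using ci dj l by (auto simp: infinity_step_def)
    ultimately show "\<not> ?E (c i) (d j)" "\<not> ?E (d j) (c i)" unfolding infinity_graph_adj by blast+
  qed
  have disj: "c i \<noteq> d j" if "i < p" "0 < j" "j < q" for i j using that l by (auto simp: c_def d_def)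
  have disj': "d j \<noteq> c i" if "j < q" "0 < i" "i < p" for i j using that l by (auto simp: c_def d_def)
  have sub: "c ` {..<p} \<union> d ` {..<q} \<subseteq> ?V" using pq l by (auto simp: V c_def d_def)
  have avoid: ?thesis if "\<exists>ps. leaf_seq ?E ps \<and> length ps = (p - 1) div 2 + (q - 1) div 2 \<and>
      fst ` set ps \<union> snd ` set ps \<subseteq> c ` {..<p} \<union> d ` {..<q} - {x}"
  proof -
    from that obtain ps where ps: "leaf_seq ?E ps" "length ps = (p - 1) div 2 + (q - 1) div 2"
      "fst ` set ps \<union> snd ` set ps \<subseteq> c ` {..<p} \<union> d ` {..<q} - {x}" by blast
    then have "fst ` set ps \<subseteq> ?V - {x}" "snd ` set ps \<subseteq> ?V - {x}" using sub by blast+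
    then have "set ps \<subseteq> (?V - {x}) \<times> (?V - {x})" by (auto simp: image_subset_iff)
    with ps show ?thesis by blast
  qed
  note cd = two_cycles_leaf_seq[OF cyc_c cyc_d _ disj nadj(1)]
  note dc = two_cycles_leaf_seq[OF cyc_d cyc_c _ disj' nadj(2)]
  consider r where "r < p" "x = c r" | r where "r < q" "x = d r" | "x \<notin> c ` {..<p} \<union> d ` {..<q}"
    by blast
  then show ?thesis
  proof cases
    case (1 r)
    then show ?thesis using cd[of r] pq by (intro avoid) simp
  next
    case (2 r)
    then show ?thesis using dc[of r] pq by (intro avoid) (simp add: add.commute Un_commute)
  next
    case 3
    from cd[of 0] pq obtain ps where "leaf_seq ?E ps" "length ps = (p - 1) div 2 + (q - 1) div 2"
      "fst ` set ps \<union> snd ` set ps \<subseteq> c ` {..<p} \<union> d ` {..<q} - {c 0}" by auto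
    with 3 show ?thesis by (intro avoid exI[of _ ps]) blast
  qed
qed

end

section \<open>Vertices outside the base\<close>

text \<open>Otherwise \<open>W\<close> would be closed under walks, contradicting
  connectedness.\<close>

lemma connected_crossing_arc:
  assumes "pair_graph G" and conn: "Digraph_Component.connected (with_proj G)"
    and W: "W \<subseteq> pverts G" "W \<noteq> {}" "W \<noteq> pverts G"
  shows "\<exists>x \<in> W. \<exists>y \<in> pverts G - W. (x, y) \<in> parcs G"
proof (rule ccontr)
  assume no: "\<not> ?thesis"
  interpret pair_graph G by fact
  obtain u v where u: "u \<in> W" and v: "v \<in> pverts G" "v \<notin> W" using W by blast
  have "(u, v) \<in> rtrancl_on (pverts G) ((parcs G)\<^sup>s)"
    using conn u v W by (auto simp: connected_conv)
  then have "v \<in> W"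
  proof (induction rule: rtrancl_on_induct)
    case (step b c)
    then have "(b, c) \<in> parcs G" using arcs_symmetric by (auto simp: symcl_def)
    with step no show ?case by blast
  qed (rule u)
  with v show False by simp
qed

lemma doubleton_mem_uedges:
  assumes "pair_graph G"
  shows "{a, b} \<in> uedges G \<longleftrightarrow> (a, b) \<in> parcs G"
proof -
  interpret pair_graph G by fact
  show ?thesis using arcs_symmetric by (auto simp: uedges_def doubleton_eq_iff)
qed

lemma finite_uedges:
  assumes "pair_graph G"
  shows "finite (uedges G)"
proof -
  interpret pair_graph G by fact
  have "uedges G = (\<lambda>(u, v). {u, v}) ` parcs G" by (auto simp: uedges_def)
  then show ?thesis using pair_finite_arcs by simp
qed

text \<open>Adding vertices outside \<open>B\<close> one at a time, each with an edge to an earlier one, uses up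
  as many edges as vertices.\<close>

lemma attach_vertices:
  assumes G: "pair_graph G" "Digraph_Component.connected (with_proj G)"
    and B: "pair_graph B" "pverts B \<subseteq> pverts G" "parcs B \<subseteq> parcs G" "pverts B \<noteq> {}"
    and "card (pverts B) + n \<le> card (pverts G)"
  shows "\<exists>W F. pverts B \<subseteq> W \<and> W \<subseteq> pverts G \<and> card W = card (pverts B) + n \<and>
    F \<subseteq> uedges G \<and> card F = card (uedges B) + n \<and>
    (\<forall>e\<in>F. e \<subseteq> W) \<and> (\<forall>e\<in>F. e \<subseteq> pverts B \<longrightarrow> e \<in> uedges B)"
  using assms(7)
proof (induction n)
  case 0
  interpret B: pair_graph B by (rule B)
  have "uedges B \<subseteq> uedges G" using B(3) by (auto simp: uedges_def)
  moreover have "\<forall>e\<in>uedges B. e \<subseteq> pverts B"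
    using B.in_arcsD1 B.in_arcsD2 by (auto simp: uedges_def)
  ultimately show ?case using B(2) by (intro exI[of _ "pverts B"] exI[of _ "uedges B"]) simp
next
  case (Suc n)
  interpret G: pair_graph G by (rule G)
  from Suc obtain W F where W: "pverts B \<subseteq> W" "W \<subseteq> pverts G" "card W = card (pverts B) + n"
    and F: "F \<subseteq> uedges G" "card F = card (uedges B) + n" "\<forall>e\<in>F. e \<subseteq> W"
      "\<forall>e\<in>F. e \<subseteq> pverts B \<longrightarrow> e \<in> uedges B" by auto
  have "W \<noteq> {}" "W \<noteq> pverts G" using W Suc.prems B(4) by auto
  with connected_crossing_arc[OF G W(2)] obtain x y where xy: "x \<in> W" "y \<in> pverts G" "y \<notin> W"
    "(x, y) \<in> parcs G" by blast
  have fin: "finite W" "finite F" using W(2) G.pair_finite_verts F(1) finite_uedges[OF G(1)]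
    finite_subset by blast+
  \<comment> \<open>The new edge is fresh because \<open>y\<close> lies outside \<open>W\<close>;
    for the same reason it is not inside the vertex set of \<open>B\<close>, so the last clause
    survives.\<close>
  have "{x, y} \<notin> F" using F(3) xy by blast
  moreover have "{x, y} \<in> uedges G" using xy by (auto simp: uedges_def)
  moreover have "\<not> {x, y} \<subseteq> pverts B" using xy W by blast
  ultimately show ?case using W F xy fin
    by (intro exI[of _ "insert y W"] exI[of _ "insert {x, y} F"]) auto
qed

text \<open>Both graphs have one edge more than vertices. Attaching all outside vertices but one
  uses all but one edge of \<open>G\<close>, so the edge \<open>{x, y}\<close> to the last vertex
  \<open>y\<close> completes the edge set. Hence \<open>y\<close> has no other neighbour, and every
  edge inside the vertex set of \<open>B\<close> belongs to \<open>B\<close>.\<close>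

lemma bicyclic_proper_subgraph:
  assumes G: "bicyclic G" and B: "bicyclic B" and sub: "subgraph (with_proj B) (with_proj G)"
    and proper: "pverts B \<noteq> pverts G"
  shows "\<exists>x y. x \<in> pverts G \<and> y \<in> pverts G - pverts B \<and> (\<forall>z. (y, z) \<in> parcs G \<longleftrightarrow> z = x)"
    and "a \<in> pverts B \<Longrightarrow> b \<in> pverts B \<Longrightarrow> (a, b) \<in> parcs G \<longleftrightarrow> (a, b) \<in> parcs B"
proof -
  have pg: "pair_graph G" "Digraph_Component.connected (with_proj G)" "pair_graph B"
    and cG: "card (uedges G) = card (pverts G) + 1" and cB: "card (uedges B) = card (pverts B) + 1"
    using G B by (auto simp: bicyclic_def)
  interpret G: pair_graph G by fact
  interpret B: pair_graph B by fact
  from sub have VB: "pverts B \<subseteq> pverts G" and AB: "parcs B \<subseteq> parcs G"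
    by (auto simp: subgraph_def)
  have ne: "pverts B \<noteq> {}"
    using B by (auto simp: bicyclic_def Digraph_Component.connected_def strongly_connected_def mk_symmetric_def)
  have less: "card (pverts B) < card (pverts G)"
    using VB proper G.pair_finite_verts by (simp add: psubset_card_mono psubset_eq)
  define n where "n = card (pverts G) - card (pverts B) - 1"
  from attach_vertices[OF pg VB AB ne, of n] less obtain W F where
    W: "pverts B \<subseteq> W" "W \<subseteq> pverts G" "card W = card (pverts B) + n"
    and F: "F \<subseteq> uedges G" "card F = card (uedges B) + n" "\<forall>e\<in>F. e \<subseteq> W"
      "\<forall>e\<in>F. e \<subseteq> pverts B \<longrightarrow> e \<in> uedges B" unfolding n_def by auto
  have "W \<noteq> {}" "W \<noteq> pverts G" using W less ne n_def by auto
  with connected_crossing_arc[OF pg(1,2) W(2)] obtain x y where xy: "x \<in> W" "y \<in> pverts G" "y \<notin> W"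
    "(x, y) \<in> parcs G" by blast
  have fin: "finite F" using F(1) finite_uedges[OF pg(1)] finite_subset by blast
  have "{x, y} \<notin> F" using F(3) xy by blast
  then have "card (insert {x, y} F) = card (uedges G)" using fin F(2) cB cG less by (simp add: n_def)
  moreover have "insert {x, y} F \<subseteq> uedges G" using F(1) xy by (auto simp: uedges_def)
  ultimately have all: "uedges G = insert {x, y} F"
    using finite_uedges[OF pg(1)] card_subset_eq by metis
  have "(y, z) \<in> parcs G \<longleftrightarrow> z = x" for z
  proof
    assume "(y, z) \<in> parcs G"
    then have "{y, z} \<in> uedges G" using doubleton_mem_uedges[OF pg(1)] by simp
    then have "{y, z} = {x, y} \<or> {y, z} \<in> F" unfolding all by simp
    moreover have "{y, z} \<notin> F" using F(3) xy by blast
    ultimately show "z = x" using xy by (auto simp: doubleton_eq_iff)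
  qed (use xy G.arcs_symmetric in blast)
  with xy W show "\<exists>x y. x \<in> pverts G \<and> y \<in> pverts G - pverts B \<and> (\<forall>z. (y, z) \<in> parcs G \<longleftrightarrow> z = x)"
    by blast
  show "(a, b) \<in> parcs G \<longleftrightarrow> (a, b) \<in> parcs B" if ab: "a \<in> pverts B" "b \<in> pverts B"
  proof
    assume "(a, b) \<in> parcs G"
    then have "{a, b} \<in> uedges G" using doubleton_mem_uedges[OF pg(1)] by simp
    then have "{a, b} = {x, y} \<or> {a, b} \<in> F" unfolding all by simp
    moreover have "{a, b} \<noteq> {x, y}" using ab xy W by (auto simp: doubleton_eq_iff)
    ultimately have "{a, b} \<in> uedges B" using F(4) ab by auto
    then show "(a, b) \<in> parcs B" using doubleton_mem_uedges[OF pg(3)] by simp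
  qed (use AB in blast)
qed

text \<open>On the same vertex set the two graphs would have equally many edges and so coincide, but
  only \<open>G\<close> has a pendant vertex.\<close>

lemma base_proper_subset:
  assumes G: "bicyclic G" and base: "is_base B G" and pend: "has_pendant G"
  shows "pverts B \<noteq> pverts G"
proof
  assume eq: "pverts B = pverts G"
  have B: "bicyclic B" "\<not> has_pendant B" and sub: "parcs B \<subseteq> parcs G"
    using base by (auto simp: is_base_def subgraph_def)
  have pg: "pair_graph G" "pair_graph B" using G B by (auto simp: bicyclic_def)
  have "card (uedges B) = card (uedges G)" using G B eq by (simp add: bicyclic_def)
  moreover have "uedges B \<subseteq> uedges G" using sub by (auto simp: uedges_def)
  ultimately have "uedges B = uedges G" using finite_uedges[OF pg(1)] card_subset_eq by blast
  then have "(a, b) \<in> parcs B \<longleftrightarrow> (a, b) \<in> parcs G" for a b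
    using doubleton_mem_uedges[OF pg(1)] doubleton_mem_uedges[OF pg(2)] by blast
  then have "parcs B = parcs G" by auto
  with eq have "B = G" by simp
  with B pend show False by simp
qed

text \<open>Extracts a plain vertex map; it runs from \<open>H\<close> to \<open>B\<close>, the
  direction in which leaf sequences are transported.\<close>

lemma digraph_iso_with_proj:
  assumes "digraph_iso (with_proj B) (with_proj H)"
  shows "\<exists>h. bij_betw h (pverts H) (pverts B) \<and>
    (\<forall>s \<in> pverts H. \<forall>t \<in> pverts H. (h s, h t) \<in> parcs B \<longleftrightarrow> (s, t) \<in> parcs H)"
proof -
  from assms obtain f where f: "pre_digraph.digraph_isomorphism (with_proj B) f"
    and H: "with_proj H = app_iso f (with_proj B)" unfolding digraph_iso_def by blast
  let ?g = "iso_verts f"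
  \<comment> \<open>The target has the projections as tail and head maps, which fixes
    \<open>iso_tail\<close> and \<open>iso_head\<close>; the arc map then acts componentwise by
    \<open>?g\<close>.\<close>
  have V: "pverts H = ?g ` pverts B" and A: "parcs H = iso_arcs f ` parcs B"
    and ht: "iso_tail f = fst" "iso_head f = snd"
    using arg_cong[OF H, of verts] arg_cong[OF H, of arcs] arg_cong[OF H, of tail] arg_cong[OF H, of head]
    by (simp_all add: fun_eq_iff)
  have inj: "inj_on ?g (pverts B)" and wf: "wf_digraph (with_proj B)"
    and arc: "(s, t) \<in> parcs B \<Longrightarrow> iso_arcs f (s, t) = (?g s, ?g t)" for s t
    using f ht by (auto simp: pre_digraph.digraph_isomorphism_def prod_eq_iff)
  interpret pair_wf_digraph B using wf by (simp add: wf_digraph_wp_iff)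
  have iff: "(?g s, ?g t) \<in> parcs H \<longleftrightarrow> (s, t) \<in> parcs B" if st: "s \<in> pverts B" "t \<in> pverts B" for s t
  proof
    assume "(?g s, ?g t) \<in> parcs H"
    then obtain s' t' where st': "(s', t') \<in> parcs B" "(?g s, ?g t) = iso_arcs f (s', t')"
      unfolding A by auto
    then have "?g s = ?g s'" "?g t = ?g t'" using arc by auto
    then show "(s, t) \<in> parcs B"
      using st st' inj in_arcsD1[OF st'(1)] in_arcsD2[OF st'(1)] by (auto dest: inj_onD)
  next
    assume "(s, t) \<in> parcs B"
    then show "(?g s, ?g t) \<in> parcs H" unfolding A using arc by (metis imageI)
  qed
  let ?h = "the_inv_into (pverts B) ?g"
  have bij: "bij_betw ?h (pverts H) (pverts B)"
    by (rule bij_betw_the_inv_into) (simp add: bij_betw_def inj V)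
  have "(?h s, ?h t) \<in> parcs B \<longleftrightarrow> (s, t) \<in> parcs H" if "s \<in> pverts H" "t \<in> pverts H" for s t
    using that iff inj unfolding V by (auto simp: the_inv_into_f_f)
  with bij show ?thesis by blast
qed

text \<open>The outside leaf \<open>y\<close> with its neighbour \<open>x\<close> comes first; the
  sequence inside the base avoids \<open>x\<close>, so none of its vertices is adjacent to
  \<open>y\<close>.\<close>

lemma leaf_seq_of_infinity_base:
  assumes pq: "p \<ge> 3" "q \<ge> 3" and l: "l \<ge> 1" and G: "bicyclic G" and pend: "has_pendant G"
    and base: "is_base B G" and iso: "digraph_iso (with_proj B) (with_proj (infinity_graph p l q))"
  shows "\<exists>ps. leaf_seq (\<lambda>s t. (s, t) \<in> parcs G) ps \<and> set ps \<subseteq> pverts G \<times> pverts G \<and>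
    length ps = Suc ((p - 1) div 2 + (q - 1) div 2)"
proof -
  let ?I = "infinity_graph p l q"
  let ?E = "\<lambda>s t. (s, t) \<in> parcs G"
  have B: "bicyclic B" and sub: "subgraph (with_proj B) (with_proj G)"
    using base by (auto simp: is_base_def)
  then have VB: "pverts B \<subseteq> pverts G" by (simp add: subgraph_def)
  note struct = bicyclic_proper_subgraph[OF G B sub base_proper_subset[OF G base pend]]
  from struct(1) obtain x y where xy: "x \<in> pverts G" "y \<in> pverts G" "y \<notin> pverts B"
    and nbr: "\<And>z. (y, z) \<in> parcs G \<longleftrightarrow> z = x" by blast
  interpret pair_graph G using G by (simp add: bicyclic_def)
  from digraph_iso_with_proj[OF iso] obtain h where h: "bij_betw h (pverts ?I) (pverts B)"
    and hE: "\<And>s t. s \<in> pverts ?I \<Longrightarrow> t \<in> pverts ?I \<Longrightarrow> (h s, h t) \<in> parcs B \<longleftrightarrow> (s, t) \<in> parcs ?I"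
    by blast
  \<comment> \<open>\<open>x'\<close> is the preimage of \<open>x\<close> if \<open>x\<close> lies
    in the base; otherwise any number will do.\<close>
  obtain x' where x': "\<And>s. s \<in> pverts ?I \<Longrightarrow> s \<noteq> x' \<Longrightarrow> h s \<noteq> x"
    using h by (metis bij_betw_def inj_onD)
  from infinity_graph_leaf_seq[OF pq l, of x'] obtain ps where ps: "leaf_seq (\<lambda>s t. (s, t) \<in> parcs ?I) ps"
    "length ps = (p - 1) div 2 + (q - 1) div 2" "set ps \<subseteq> (pverts ?I - {x'}) \<times> (pverts ?I - {x'})" by blast
  let ?ps = "map (map_prod h h) ps"
  have hV: "h s \<in> pverts B" if "s \<in> pverts ?I" for s using h that by (auto simp: bij_betw_def)
  have "leaf_seq ?E ?ps"
    by (rule leaf_seq_map[OF ps(1,3)]) (use hE hV struct(2) in auto)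
  moreover have set_ps: "v \<in> pverts B \<and> v \<noteq> x" if "v \<in> fst ` set ?ps \<union> snd ` set ?ps" for v
    using that ps(3) hV x' by fastforce
  moreover have "\<not> ?E y y" using no_loops' by blast
  ultimately have "leaf_seq ?E ((y, x) # ?ps)"
    using nbr unfolding leaf_seq_Cons by blast
  moreover have "set ((y, x) # ?ps) \<subseteq> pverts G \<times> pverts G" using xy set_ps VB by force
  ultimately show ?thesis using ps(2) by (intro exI[of _ "(y, x) # ?ps"]) simp
qed

lemma neg_inertia_ge_of_infinity_base:
  assumes "p \<ge> 3" "q \<ge> 3" "l \<ge> 1" "bicyclic G" "weighting G w" "has_pendant G" "is_base B G"
    and "digraph_iso (with_proj B) (with_proj (infinity_graph p l q))"
  shows "Suc ((p - 1) div 2 + (q - 1) div 2) \<le> neg_inertia G w"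
proof -
  from leaf_seq_of_infinity_base[OF assms(1-4,6-8)] obtain ps where
    ps: "leaf_seq (\<lambda>s t. (s, t) \<in> parcs G) ps" "set ps \<subseteq> pverts G \<times> pverts G"
      "length ps = Suc ((p - 1) div 2 + (q - 1) div 2)" by blast
  have "pair_graph G" using assms(4) by (simp add: bicyclic_def)
  from neg_inertia_ge_leaf_seq[OF this assms(5) ps(1,2)] ps(3) show ?thesis by simp
qed

section \<open>Arithmetic of the bound, and tools for concrete graphs\<close>

lemma inertia_bound_eq:
  assumes "p \<ge> 1" "q \<ge> 1"
  shows "inertia_bound p q = real (Suc ((p - 1) div 2 + (q - 1) div 2))"
proof -
  \<comment> \<open>Rounding in \<open>(m - 1) div 2\<close> loses one half exactly for even
    \<open>m\<close>, which accounts for the three cases of the bound.\<close>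
  have half: "2 * real ((m - 1) div 2) = real m - (if even m then 2 else 1)" if "m \<ge> 1" for m
  proof (cases "even m")
    case True
    then obtain k where k: "m = 2 * k" by blast
    then have "(m - 1) div 2 = k - 1" using that by presburger
    then show ?thesis using k that by simp
  next
    case False
    then obtain k where "m = 2 * k + 1" by (rule oddE)
    then show ?thesis by simp
  qed
  show ?thesis using half[OF assms(1)] half[OF assms(2)] unfolding inertia_bound_def by auto
qed

lemma digraph_iso_refl:
  assumes "pair_graph B"
  shows "digraph_iso (with_proj B) (with_proj B)"
proof -
  interpret pair_graph B by fact
  let ?f = "\<lparr>iso_verts = id, iso_arcs = id, iso_head = snd, iso_tail = fst\<rparr>"
  have "pre_digraph.digraph_isomorphism (with_proj B) ?f"
    unfolding pre_digraph.digraph_isomorphism_def using wf_digraph_axioms by simp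
  moreover have "with_proj B = app_iso ?f (with_proj B)" by (simp add: app_iso_def with_proj_def)
  ultimately show ?thesis unfolding digraph_iso_def by blast
qed

lemma pair_graphI:
  assumes "finite V" "R \<subseteq> V \<times> V" "sym R" "irrefl R"
  shows "pair_graph \<lparr>pverts = V, parcs = R\<rparr>"
proof unfold_locales
  show "finite (parcs \<lparr>pverts = V, parcs = R\<rparr>)"
    using assms finite_subset[OF assms(2)] by simp
  show "symmetric (with_proj \<lparr>pverts = V, parcs = R\<rparr>)" using assms(3) by (simp add: symmetric_def)
qed (use assms in \<open>auto simp: irrefl_def\<close>)

text \<open>Descending through smaller neighbours joins every vertex to \<open>0\<close>. It serves
  for both graphs of the extremal example.\<close>

lemma connected_of_smaller_neighbour:
  fixes G :: "nat pair_pre_digraph"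
  assumes "pair_graph G" and V: "pverts G = {0..<n}" "n > 0"
    and nbr: "\<And>t. 0 < t \<Longrightarrow> t < n \<Longrightarrow> \<exists>s<t. (s, t) \<in> parcs G"
  shows "Digraph_Component.connected (with_proj G)"
proof -
  interpret pair_graph G by fact
  let ?R = "rtrancl_on {0..<n} ((parcs G)\<^sup>s)"
  have from0: "(0, v) \<in> ?R" if "v < n" for v
    using that
  proof (induction v rule: less_induct)
    case (less v)
    show ?case
    proof (cases "v = 0")
      case False
      with less nbr obtain s where s: "s < v" "(s, v) \<in> parcs G" by blast
      have "(0, s) \<in> ?R" using less s(1) by simp
      moreover have "(s, v) \<in> (parcs G)\<^sup>s" using s(2) by (simp add: symcl_def)
      moreover have "v \<in> {0..<n}" using less.prems by simp
      ultimately show ?thesis by (rule rtrancl_on_into_rtrancl_on)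
    qed (use V in auto)
  qed
  have "sym ((parcs G)\<^sup>s)" by (auto simp: symcl_def sym_def)
  then have sym: "sym ?R" by (rule rtrancl_on_sym)
  have "(u, v) \<in> ?R" if "u < n" "v < n" for u v
    by (rule rtrancl_on_trans[OF symD[OF sym from0[OF that(1)]] from0[OF that(2)]])
  then show ?thesis unfolding connected_conv using V by auto
qed

section \<open>The extremal graph\<close>

context
  fixes p q :: nat
  assumes pq: "p \<ge> 3" "q \<ge> 3"
begin

text \<open>For \<open>l = 1\<close> the numbering runs through both cycles in one sweep from
  \<open>0\<close> to \<open>p + q - 2\<close>, and the two closing arcs return to \<open>0\<close>
  and to the shared vertex \<open>p - 1\<close>.\<close>

lemma infinity_step_Suc_0:
  "infinity_step p (Suc 0) q s t \<longleftrightarrow>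
    Suc s < p + q - 1 \<and> t = Suc s \<or> s = p - 1 \<and> t = 0 \<or> s = p + q - 2 \<and> t = p - 1"
proof -
  have 1: "s < p \<and> t = Suc s mod p \<longleftrightarrow> Suc s < p \<and> t = Suc s \<or> s = p - 1 \<and> t = 0"
    using pq by (cases "Suc s = p") auto
  have 2: "p - 1 \<le> s \<and> s < p - 1 + q \<and> t = p - 1 + Suc (s - (p - 1)) mod q \<longleftrightarrow>
      p - 1 \<le> s \<and> Suc s < p + q - 1 \<and> t = Suc s \<or> s = p + q - 2 \<and> t = p - 1"
    using pq by (cases "Suc (s - (p - 1)) = q") auto
  have "p + Suc 0 - 2 = p - 1" by simp
  then have "infinity_step p (Suc 0) q s t \<longleftrightarrow> (s < p \<and> t = Suc s mod p) \<or>
      (p - 1 \<le> s \<and> s < p - 1 + q \<and> t = p - 1 + Suc (s - (p - 1)) mod q)"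
    unfolding infinity_step_def by auto
  then show ?thesis unfolding 1 2 using pq by auto
qed

abbreviation "figure_eight \<equiv> infinity_graph p (Suc 0) q"

lemma figure_eight_verts: "pverts figure_eight = {0..<p + q - 1}"
  by (simp add: infinity_graph_def Let_def)

lemma figure_eight_arcs: "(s, t) \<in> parcs figure_eight \<longleftrightarrow>
    (Suc s < p + q - 1 \<and> t = Suc s \<or> s = p - 1 \<and> t = 0 \<or> s = p + q - 2 \<and> t = p - 1) \<or>
    (Suc t < p + q - 1 \<and> s = Suc t \<or> t = p - 1 \<and> s = 0 \<or> t = p + q - 2 \<and> s = p - 1)"
  unfolding infinity_graph_adj infinity_step_Suc_0 ..

text \<open>The new vertex \<open>p + q - 1\<close> hangs at the shared vertex \<open>p - 1\<close>;
  deleting both leaves disjoint paths on \<open>p - 1\<close> and \<open>q - 1\<close>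
  vertices.\<close>

definition pendant_graph :: "nat pair_pre_digraph" where
  "pendant_graph = \<lparr>pverts = {0..<p + q}, parcs = parcs figure_eight \<union> {(p - 1, p + q - 1), (p + q - 1, p - 1)}\<rparr>"

lemma figure_eight_arcs_props: "parcs figure_eight \<subseteq> pverts figure_eight \<times> pverts figure_eight" "sym (parcs figure_eight)" "irrefl (parcs figure_eight)"
  using pq by (auto simp: figure_eight_verts figure_eight_arcs sym_def irrefl_def)

lemma pair_graph_figure_eight: "pair_graph figure_eight"
proof -
  have "finite (pverts figure_eight)" by (simp add: figure_eight_verts)
  moreover have "\<lparr>pverts = pverts figure_eight, parcs = parcs figure_eight\<rparr> = figure_eight"
    by (rule pair_pre_digraph.equality) simp_all
  ultimately show ?thesis using pair_graphI[OF _ figure_eight_arcs_props] by metis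
qed

lemma pair_graph_pendant: "pair_graph pendant_graph"
  unfolding pendant_graph_def
proof (rule pair_graphI)
  show "parcs figure_eight \<union> {(p - 1, p + q - 1), (p + q - 1, p - 1)} \<subseteq> {0..<p + q} \<times> {0..<p + q}"
    using figure_eight_arcs_props(1) pq by (auto simp: figure_eight_verts)
  show "sym (parcs figure_eight \<union> {(p - 1, p + q - 1), (p + q - 1, p - 1)})"
    using figure_eight_arcs_props(2) by (auto simp: sym_def)
  show "irrefl (parcs figure_eight \<union> {(p - 1, p + q - 1), (p + q - 1, p - 1)})"
    using figure_eight_arcs_props(3) pq by (auto simp: irrefl_def)
qed simp

lemma connected_figure_eight: "Digraph_Component.connected (with_proj figure_eight)"
proof (rule connected_of_smaller_neighbour[OF pair_graph_figure_eight figure_eight_verts])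
  fix t assume "0 < t" "t < p + q - 1"
  then show "\<exists>s<t. (s, t) \<in> parcs figure_eight" by (intro exI[of _ "t - 1"]) (simp add: figure_eight_arcs)
qed (use pq in simp)

lemma connected_pendant: "Digraph_Component.connected (with_proj pendant_graph)"
proof (rule connected_of_smaller_neighbour[OF pair_graph_pendant])
  fix t assume t: "0 < t" "t < p + q"
  show "\<exists>s<t. (s, t) \<in> parcs pendant_graph"
  proof (cases "t = p + q - 1")
    case True
    then show ?thesis using pq by (intro exI[of _ "p - 1"]) (simp add: pendant_graph_def)
  next
    case False
    with t have "t < p + q - 1" by linarith
    with t show ?thesis by (intro exI[of _ "t - 1"]) (simp add: pendant_graph_def figure_eight_arcs)
  qed
qed (use pq in \<open>auto simp: pendant_graph_def\<close>)

lemma card_uedges_figure_eight: "card (uedges figure_eight) = p + q"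
proof -
  let ?P = "(\<lambda>i. {i, Suc i}) ` {..<p + q - 2}"
  have "uedges figure_eight = insert {p - 1, 0} (insert {p + q - 2, p - 1} ?P)"
  proof (rule equalityI; rule subsetI)
    fix e assume "e \<in> uedges figure_eight"
    then show "e \<in> insert {p - 1, 0} (insert {p + q - 2, p - 1} ?P)"
      unfolding uedges_def figure_eight_arcs by (auto simp: insert_commute)
  next
    fix e assume "e \<in> insert {p - 1, 0} (insert {p + q - 2, p - 1} ?P)"
    then show "e \<in> uedges figure_eight"
      using pq by (auto simp: doubleton_mem_uedges[OF pair_graph_figure_eight] figure_eight_arcs)
  qed
  moreover have "inj_on (\<lambda>i. {i, Suc i}) {..<p + q - 2}" by (auto simp: inj_on_def doubleton_eq_iff)
  then have "card ?P = p + q - 2" by (simp add: card_image)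
  \<comment> \<open>Length at least 3 keeps both closing edges apart from the edges between
    consecutive numbers.\<close>
  moreover have "{p + q - 2, p - 1} \<notin> ?P" "{p - 1, 0} \<notin> ?P" "{p - 1, 0} \<noteq> {p + q - 2, p - 1}"
    using pq by (auto simp: doubleton_eq_iff)
  ultimately show ?thesis using pq by simp
qed

lemma card_uedges_pendant: "card (uedges pendant_graph) = p + q + 1"
proof -
  have "uedges pendant_graph = insert {p - 1, p + q - 1} (uedges figure_eight)"
    unfolding uedges_def pendant_graph_def by (auto simp: insert_commute)
  moreover have "{p - 1, p + q - 1} \<notin> uedges figure_eight"
    unfolding doubleton_mem_uedges[OF pair_graph_figure_eight] using figure_eight_arcs_props(1) by (auto simp: figure_eight_verts)
  ultimately show ?thesis using card_uedges_figure_eight finite_uedges[OF pair_graph_figure_eight] by simp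
qed

text \<open>Every vertex has two neighbours: predecessor and successor, with \<open>p - 1\<close>
  replacing the missing one at either end of the numbering.\<close>

lemma no_pendant_figure_eight: "\<not> has_pendant figure_eight"
proof
  assume "has_pendant figure_eight"
  then obtain v where v: "v < p + q - 1" and "card {e \<in> parcs figure_eight. fst e = v} = 1"
    by (auto simp: has_pendant_def out_degree_def out_arcs_def figure_eight_verts)
  then obtain e where "{e \<in> parcs figure_eight. fst e = v} = {e}" by (auto simp: card_1_singleton_iff)
  then have uniq: "t = t'" if "(v, t) \<in> parcs figure_eight" "(v, t') \<in> parcs figure_eight" for t t'
    using that by (metis (mono_tags, lifting) fst_conv mem_Collect_eq singletonD snd_conv)
  consider "v = 0" | "v = p + q - 2" | "0 < v" "v < p + q - 2" using v by linarith
  then show False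
  proof cases
    case 1
    have "1 < p + q - 1" "1 \<noteq> p - 1" using pq by linarith+
    with 1 show False using uniq[of 1 "p - 1"] by (simp add: figure_eight_arcs)
  next
    case 2
    have "Suc (p + q - 3) < p + q - 1" "p + q - 2 = Suc (p + q - 3)" "p + q - 3 \<noteq> p - 1"
      using pq by linarith+
    with 2 show False using uniq[of "p + q - 3" "p - 1"] by (simp add: figure_eight_arcs)
  next
    case 3
    then have "Suc v < p + q - 1" "v < p + q - 1" "Suc (v - 1) = v" "v - 1 \<noteq> Suc v"
      using pq by linarith+
    then show False using uniq[of "v - 1" "Suc v"] by (simp add: figure_eight_arcs)
  qed
qed

lemma has_pendant_pendant: "has_pendant pendant_graph"
proof -
  have "{e \<in> parcs pendant_graph. fst e = p + q - 1} = {(p + q - 1, p - 1)}"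
    using figure_eight_arcs_props(1) pq by (auto simp: pendant_graph_def figure_eight_verts)
  then show ?thesis unfolding has_pendant_def out_degree_def out_arcs_def
    using pq by (intro bexI[of _ "p + q - 1"]) (simp_all add: pendant_graph_def)
qed

lemma bicyclic_figure_eight: "bicyclic figure_eight"
  using pair_graph_figure_eight connected_figure_eight card_uedges_figure_eight pq by (simp add: bicyclic_def figure_eight_verts)

lemma bicyclic_pendant: "bicyclic pendant_graph"
  using pair_graph_pendant connected_pendant card_uedges_pendant
  by (simp add: bicyclic_def) (simp add: pendant_graph_def)

lemma is_base_figure_eight: "is_base figure_eight pendant_graph"
proof -
  interpret I: pair_graph figure_eight by (rule pair_graph_figure_eight)
  interpret P: pair_graph pendant_graph by (rule pair_graph_pendant)
  have "subgraph (with_proj figure_eight) (with_proj pendant_graph)"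
    using I.wf_digraph_axioms P.wf_digraph_axioms
    by (auto simp: subgraph_def compatible_def figure_eight_verts pendant_graph_def)
  then show ?thesis using bicyclic_figure_eight no_pendant_figure_eight by (simp add: is_base_def)
qed

lemma neg_inertia_pendant_le:
  assumes "weighting pendant_graph w"
  shows "neg_inertia pendant_graph w \<le> Suc ((p - 1) div 2 + (q - 1) div 2)"
proof -
  \<comment> \<open>Every other vertex of the paths \<open>0, ..., p - 2\<close> and
    \<open>p, ..., p + q - 2\<close>, beginning with the first.\<close>
  let ?P = "(\<lambda>i. 2 * i) ` {..<p div 2}" and ?Q = "(\<lambda>i. p + 2 * i) ` {..<q div 2}"
  let ?R = "insert (p + q - 1) (?P \<union> ?Q)"
  have P: "even s \<and> s < p - 1" if "s \<in> ?P" for s using that pq by auto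
  have Q: "even (s - p) \<and> p \<le> s \<and> s < p + q - 1" if "s \<in> ?Q" for s using that pq by auto
  have lt: "s < p + q - 1 \<and> s \<noteq> p - 1" if "s \<in> ?P \<union> ?Q" for s using that P Q pq by fastforce
  \<comment> \<open>Within each set all numbers have the same parity, and the gap at
    \<open>p - 1\<close> separates the two sets.\<close>
  have suc: "t \<noteq> Suc s" if "s \<in> ?P \<union> ?Q" "t \<in> ?P \<union> ?Q" for s t
    using that pq by auto presburger+
  have nadj: "(s, t) \<notin> parcs figure_eight" if "s \<in> ?P \<union> ?Q" "t \<in> ?P \<union> ?Q" for s t
    using lt[OF that(1)] lt[OF that(2)] suc[OF that] suc[OF that(2,1)] unfolding figure_eight_arcs by blast
  have "(s, t) \<notin> parcs pendant_graph" if "s \<in> ?R" "t \<in> ?R" for s t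
  proof -
    have "s \<noteq> p - 1" "t \<noteq> p - 1" using that lt pq by auto
    moreover have "(s, t) \<notin> parcs figure_eight"
    proof (cases "s = p + q - 1 \<or> t = p + q - 1")
      case True
      then show ?thesis using figure_eight_arcs_props(1) by (auto simp: figure_eight_verts)
    qed (use that nadj in blast)
    ultimately show ?thesis by (auto simp: pendant_graph_def)
  qed
  moreover have "?R \<subseteq> pverts pendant_graph" using lt pq by (fastforce simp: pendant_graph_def)
  moreover have "card (pverts pendant_graph) = p + q" by (simp add: pendant_graph_def)
  ultimately have "neg_inertia pendant_graph w + card ?R \<le> p + q"
    using neg_inertia_le_independent[OF pair_graph_pendant assms, of ?R] by metis
  moreover have "?P \<inter> ?Q = {}" by auto
  then have "card (?P \<union> ?Q) = p div 2 + q div 2"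
    by (simp add: card_Un_disjoint card_image inj_on_def)
  moreover have "p + q - 1 \<notin> ?P \<union> ?Q" using lt by blast
  ultimately have "neg_inertia pendant_graph w + Suc (p div 2 + q div 2) \<le> p + q" by simp
  \<comment> \<open>The vertices left over on the two paths number \<open>(p - 1) div 2\<close> and
    \<open>(q - 1) div 2\<close>; with \<open>p - 1\<close> itself they give exactly the lower
    bound.\<close>
  moreover have "p = Suc (p div 2 + (p - 1) div 2)" "q = Suc (q div 2 + (q - 1) div 2)"
    using pq by presburger+
  ultimately show ?thesis by linarith
qed

end

section \<open>The bound and its sharpness\<close>

theorem theorem3p2:
  fixes p q :: nat
  assumes "p \<ge> 3" and "q \<ge> 3"
  shows "(\<forall>(l::nat) (n::nat) (G :: 'a pair_pre_digraph) B (w :: ('a \<times> 'a) weight_fun).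
            l \<ge> 1 \<and> bicyclic G \<and> weighting G w \<and> card (pverts G) = n \<and> has_pendant G \<and>
            is_base B G \<and> digraph_iso (with_proj B) (with_proj (infinity_graph p l q)) \<longrightarrow>
            real (neg_inertia G w) \<ge> inertia_bound p q) \<and>
         (\<exists>(l::nat) (G :: nat pair_pre_digraph) B (w :: (nat \<times> nat) weight_fun).
            l \<ge> 1 \<and> bicyclic G \<and> weighting G w \<and> has_pendant G \<and>
            is_base B G \<and> digraph_iso (with_proj B) (with_proj (infinity_graph p l q)) \<and>
            real (neg_inertia G w) = inertia_bound p q)"
proof (rule conjI)
  have bound: "inertia_bound p q = real (Suc ((p - 1) div 2 + (q - 1) div 2))"
    using assms by (intro inertia_bound_eq) simp_all
  show "\<forall>(l::nat) (n::nat) (G :: 'a pair_pre_digraph) B (w :: ('a \<times> 'a) weight_fun).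
            l \<ge> 1 \<and> bicyclic G \<and> weighting G w \<and> card (pverts G) = n \<and> has_pendant G \<and>
            is_base B G \<and> digraph_iso (with_proj B) (with_proj (infinity_graph p l q)) \<longrightarrow>
            real (neg_inertia G w) \<ge> inertia_bound p q"
    unfolding bound of_nat_le_iff using neg_inertia_ge_of_infinity_base[OF assms] by blast
  \<comment> \<open>Sharpness is attained for all \<open>p\<close> and \<open>q\<close> already with
    \<open>l = 1\<close> and unit weights.\<close>
  let ?G = "pendant_graph p q" and ?w = "\<lambda>_. 1 :: real" and ?B = "infinity_graph p (Suc 0) q"
  have w: "weighting ?G ?w" by (simp add: weighting_def)
  have iso: "digraph_iso (with_proj ?B) (with_proj ?B)"
    by (rule digraph_iso_refl[OF pair_graph_figure_eight[OF assms]])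
  note G = bicyclic_pendant[OF assms] w has_pendant_pendant[OF assms] is_base_figure_eight[OF assms] iso
  have "Suc ((p - 1) div 2 + (q - 1) div 2) \<le> neg_inertia ?G ?w"
    using neg_inertia_ge_of_infinity_base[OF assms _ G] by simp
  with neg_inertia_pendant_le[OF assms w] have "real (neg_inertia ?G ?w) = inertia_bound p q"
    unfolding bound by simp
  with G show "\<exists>(l::nat) (G :: nat pair_pre_digraph) B (w :: (nat \<times> nat) weight_fun).
            l \<ge> 1 \<and> bicyclic G \<and> weighting G w \<and> has_pendant G \<and>
            is_base B G \<and> digraph_iso (with_proj B) (with_proj (infinity_graph p l q)) \<and>
            real (neg_inertia G w) = inertia_bound p q"
    by (intro exI[of _ "Suc 0"] exI[of _ ?G] exI[of _ ?B] exI[of _ ?w] conjI) simp_all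
qed

end
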